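(* Let $f:\mathbb{N}\to\mathbb{R}$ be any function (with $0\in\mathbb{N}$), defining the Thiele score $\mathrm{sc}_f(W)=\sum_{i\in N} f(|A(i)\cap W|)$; this includes Proportional Approval Voting, $f(r)=\sum_{j=1}^r 1/j$, and Chamberlin–Courant approval voting, $f(r)=\min(1,r)$. Consider the online approval committee election problem with $n$ voters, $m$ candidates and committee size $k\le m$ with this score, and assume (UI): each voter approves each candidate with the same known probability $p\in[0,1]$, all these approval events being independent. If the number of voters $n$ is a constant, then an optimal safe policy (a safe policy maximizing the expected score of the selected committee among all safe policies) can be computed in time polynomial in $m$ and $k$.
   Context: Setting. There are voters $N=\{1,\dots,n\}$ and $m$ candidates $c_1,\dots,c_m$ appearing one at a time in this order; exactly $k\le m$ of them have to be selected. When $c_t$ appears, the set $N(c_t)\subseteq N$ of voters approving $c_t$ is revealed, and it must be decided immediately and irrevocably whether $c_t$ is selected ("yes") or not ("no"), without knowledge of the approvals of later candidates. $A(i)$ denotes the set of all candidates approved by voter $i$. Assumption (UI). The events "voter $i$ approves candidate $c_t$" ($i\in N$, $1\le t\le m$) are mutually independent and each has probability $p$, which is known in advance. Policies. A history is a sequence $\langle (c_t,N(c_t),a_t) : t=1,\dots,q\rangle$, $q\le m$, with $a_t\in\{\text{yes},\text{no}\}$; it is terminal if $q=m$ or the number of selected candidates is $k$. A policy $\pi$ decides, at each step $t$ and after $N(c_t)$ is observed, whether $c_t$ is selected. A policy is safe if every terminal history it induces selects exactly $k$ candidates. For a terminal history $h$ of a safe policy, $W(h)$ is the set of selected candidates.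 The expected score of a safe policy $\pi$ is $\mathbb{E}_{h\sim\pi}[\mathrm{sc}_f(W(h))]$, where the distribution over histories is induced by the random approvals and $\pi$. An optimal safe policy is a safe policy with maximal expected score. Representation of the output. A policy is represented as a table mapping each state to an action in $\{\text{yes},\text{no}\}$, where a state records the number of candidates seen so far (including the current one), the number of candidates selected so far, the set of voters approving the current candidate, and, for each voter $i$, the number of already selected candidates approved by $i$. The input is $(m,k,p)$ together with the values $f(0),\dots,f(k)$, and running time counts elementary arithmetic operations and comparisons on real numbers at unit cost. *)

theory Defs
  imports "HOL-Probability.Product_PMF"
begin

section \<open>Online approval committee elections\<close>

text \<open>
  Voters are \<open>1..n\<close>, and the candidate \<open>c\<^sub>t\<close> is identified with its arrival time \<open>t\<close>, \<open>1 \<le> t \<le> m\<close>.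
  A profile maps \<open>(i, t)\<close> to the truth value of ``voter \<open>i\<close> approves \<open>c\<^sub>t\<close>''.
\<close>

type_synonym profile = "nat \<times> nat \<Rightarrow> bool"

definition approvals_pmf :: "nat \<Rightarrow> nat \<Rightarrow> real \<Rightarrow> profile pmf" where
  "approvals_pmf n m p = Pi_pmf ({1..n} \<times> {1..m}) False (\<lambda>_. bernoulli_pmf p)"

definition approvers :: "nat \<Rightarrow> profile \<Rightarrow> nat \<Rightarrow> nat set" where
  "approvers n \<omega> t = {i \<in> {1..n}. \<omega> (i, t)}"

definition approved :: "nat \<Rightarrow> profile \<Rightarrow> nat \<Rightarrow> nat set" where
  "approved m \<omega> i = {t \<in> {1..m}. \<omega> (i, t)}"

definition thiele_score :: "(nat \<Rightarrow> real) \<Rightarrow> nat \<Rightarrow> nat \<Rightarrow> profile \<Rightarrow> nat set \<Rightarrow> real" where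
  "thiele_score f n m \<omega> W = (\<Sum>i\<in>{1..n}. f (card (approved m \<omega> i \<inter> W)))"

text \<open>
  The triple for \<open>c\<^sub>t\<close> in a history is the list entry at position \<open>t - 1\<close>, so that only its
  last two components need to be stored: the approving voters and the action (\<open>True\<close> for ``yes'').
  A policy maps the past history and the set of voters approving the current candidate
  to an action.
\<close>

type_synonym history = "(nat set \<times> bool) list"
type_synonym policy = "history \<Rightarrow> nat set \<Rightarrow> bool"

definition selected :: "history \<Rightarrow> nat set" where
  "selected h = {t \<in> {1..length h}. snd (h ! (t - 1))}"

definition terminal :: "nat \<Rightarrow> nat \<Rightarrow> history \<Rightarrow> bool" where
  "terminal m k h \<longleftrightarrow> length h = m \<or> card (selected h) = k"

text \<open>
  The histories that a policy can produce, under any approvals whatsoever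
  (also those of probability 0, which exist if \<open>p\<close> is 0 or 1).
\<close>

inductive induced :: "nat \<Rightarrow> nat \<Rightarrow> nat \<Rightarrow> policy \<Rightarrow> history \<Rightarrow> bool"
  for n m k :: nat and \<pi> :: policy where
  induced_Nil: "induced n m k \<pi> []"
| induced_snoc: "induced n m k \<pi> h \<Longrightarrow> \<not> terminal m k h \<Longrightarrow> S \<subseteq> {1..n}
    \<Longrightarrow> induced n m k \<pi> (h @ [(S, \<pi> h S)])"

definition safe_policy :: "nat \<Rightarrow> nat \<Rightarrow> nat \<Rightarrow> policy \<Rightarrow> bool" where
  "safe_policy n m k \<pi> \<longleftrightarrow>
     (\<forall>h. induced n m k \<pi> h \<and> terminal m k h \<longrightarrow> card (selected h) = k)"

text \<open>The history after \<open>q\<close> steps; it is frozen once it is terminal.\<close>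

primrec play :: "nat \<Rightarrow> nat \<Rightarrow> nat \<Rightarrow> policy \<Rightarrow> profile \<Rightarrow> nat \<Rightarrow> history" where
  "play n m k \<pi> \<omega> 0 = []"
| "play n m k \<pi> \<omega> (Suc q) =
     (let h = play n m k \<pi> \<omega> q; S = approvers n \<omega> (Suc q)
      in if terminal m k h then h else h @ [(S, \<pi> h S)])"

definition expected_score ::
  "nat \<Rightarrow> nat \<Rightarrow> nat \<Rightarrow> real \<Rightarrow> (nat \<Rightarrow> real) \<Rightarrow> policy \<Rightarrow> real" where
  "expected_score n m k p f \<pi> =
     measure_pmf.expectation (approvals_pmf n m p)
       (\<lambda>\<omega>. thiele_score f n m \<omega> (selected (play n m k \<pi> \<omega> m)))"

definition optimal_safe_policy ::
  "nat \<Rightarrow> nat \<Rightarrow> nat \<Rightarrow> real \<Rightarrow> (nat \<Rightarrow> real) \<Rightarrow> policy \<Rightarrow> bool" where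
  "optimal_safe_policy n m k p f \<pi> \<longleftrightarrow>
     safe_policy n m k \<pi> \<and>
     (\<forall>\<pi>'. safe_policy n m k \<pi>' \<longrightarrow> expected_score n m k p f \<pi>' \<le> expected_score n m k p f \<pi>)"

section \<open>A real RAM\<close>

text \<open>
  A structured programming language over two kinds of named arrays, holding natural
  numbers and real numbers respectively. Arrays are multi-dimensional: a cell is addressed
  by a tuple of naturals (the empty tuple for a scalar variable), whose length
  is fixed by the program text.

  Reals are handled exactly and only by field operations and comparisons. In particular there are
  no real constants other than 0 and 1, and no rounding. Naturals have addition and truncated
  subtraction but no multiplication, so that their bit length, too, is bounded by the
  running time (up to a constant and the bit length of the input).
\<close>

type_synonym vname = string

datatype iexp =
    IConst nat
  | IGet vname "iexp list"
  | IAdd iexp iexp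
  | ISub iexp iexp

datatype rexp =
    RZero
  | ROne
  | RGet vname "iexp list"
  | RAdd rexp rexp
  | RSub rexp rexp
  | RMul rexp rexp
  | RDiv rexp rexp

datatype bexp =
    ILe iexp iexp
  | RLe rexp rexp
  | BNot bexp
  | BAnd bexp bexp

datatype com =
    Skip
  | IPut vname "iexp list" iexp
  | RPut vname "iexp list" rexp
  | Seq com com
  | Cond bexp com com
  | While bexp com

type_synonym istore = "vname \<Rightarrow> nat list \<Rightarrow> nat"
type_synonym rstore = "vname \<Rightarrow> nat list \<Rightarrow> real"
type_synonym store = "istore \<times> rstore"

primrec ival :: "istore \<Rightarrow> iexp \<Rightarrow> nat" where
  "ival I (IConst c) = c"
| "ival I (IGet x es) = I x (map (ival I) es)"
| "ival I (IAdd a b) = ival I a + ival I b"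
| "ival I (ISub a b) = ival I a - ival I b"

primrec rval :: "store \<Rightarrow> rexp \<Rightarrow> real" where
  "rval s RZero = 0"
| "rval s ROne = 1"
| "rval s (RGet x es) = snd s x (map (ival (fst s)) es)"
| "rval s (RAdd a b) = rval s a + rval s b"
| "rval s (RSub a b) = rval s a - rval s b"
| "rval s (RMul a b) = rval s a * rval s b"
| "rval s (RDiv a b) = rval s a / rval s b"

primrec bval :: "store \<Rightarrow> bexp \<Rightarrow> bool" where
  "bval s (ILe a b) \<longleftrightarrow> ival (fst s) a \<le> ival (fst s) b"
| "bval s (RLe a b) \<longleftrightarrow> rval s a \<le> rval s b"
| "bval s (BNot b) \<longleftrightarrow> \<not> bval s b"
| "bval s (BAnd a b) \<longleftrightarrow> bval s a \<and> bval s b"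

text \<open>
  Every constant, memory access, arithmetic operation, comparison and connective costs one unit,
  including those needed to compute addresses.
\<close>

primrec icost :: "iexp \<Rightarrow> nat" where
  "icost (IConst c) = 1"
| "icost (IGet x es) = 1 + sum_list (map icost es)"
| "icost (IAdd a b) = 1 + icost a + icost b"
| "icost (ISub a b) = 1 + icost a + icost b"

primrec rcost :: "rexp \<Rightarrow> nat" where
  "rcost RZero = 1"
| "rcost ROne = 1"
| "rcost (RGet x es) = 1 + sum_list (map icost es)"
| "rcost (RAdd a b) = 1 + rcost a + rcost b"
| "rcost (RSub a b) = 1 + rcost a + rcost b"
| "rcost (RMul a b) = 1 + rcost a + rcost b"
| "rcost (RDiv a b) = 1 + rcost a + rcost b"

primrec bcost :: "bexp \<Rightarrow> nat" where
  "bcost (ILe a b) = 1 + icost a + icost b"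
| "bcost (RLe a b) = 1 + rcost a + rcost b"
| "bcost (BNot b) = 1 + bcost b"
| "bcost (BAnd a b) = 1 + bcost a + bcost b"

definition upd :: "('v \<Rightarrow> 'i \<Rightarrow> 'a) \<Rightarrow> 'v \<Rightarrow> 'i \<Rightarrow> 'a \<Rightarrow> 'v \<Rightarrow> 'i \<Rightarrow> 'a" where
  "upd A x j v = A(x := (A x)(j := v))"

text \<open>\<open>exec c s T s'\<close>: started in \<open>s\<close>, the program \<open>c\<close> halts in \<open>s'\<close> after exactly \<open>T\<close> time units.\<close>

inductive exec :: "com \<Rightarrow> store \<Rightarrow> nat \<Rightarrow> store \<Rightarrow> bool" where
  exec_Skip: "exec Skip s 1 s"
| exec_IPut: "exec (IPut x es a) (I, R) (1 + sum_list (map icost es) + icost a)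
    (upd I x (map (ival I) es) (ival I a), R)"
| exec_RPut: "exec (RPut x es a) (I, R) (1 + sum_list (map icost es) + rcost a)
    (I, upd R x (map (ival I) es) (rval (I, R) a))"
| exec_Seq: "exec c\<^sub>1 s T\<^sub>1 s' \<Longrightarrow> exec c\<^sub>2 s' T\<^sub>2 s'' \<Longrightarrow> exec (Seq c\<^sub>1 c\<^sub>2) s (T\<^sub>1 + T\<^sub>2) s''"
| exec_CondT: "bval s b \<Longrightarrow> exec c\<^sub>1 s T s' \<Longrightarrow> exec (Cond b c\<^sub>1 c\<^sub>2) s (1 + bcost b + T) s'"
| exec_CondF: "\<not> bval s b \<Longrightarrow> exec c\<^sub>2 s T s' \<Longrightarrow> exec (Cond b c\<^sub>1 c\<^sub>2) s (1 + bcost b + T) s'"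
| exec_WhileF: "\<not> bval s b \<Longrightarrow> exec (While b c) s (1 + bcost b) s"
| exec_WhileT: "bval s b \<Longrightarrow> exec c s T s' \<Longrightarrow> exec (While b c) s' T' s''
    \<Longrightarrow> exec (While b c) s (1 + bcost b + T + T') s''"

lemma exec_deterministic:
  "exec c s T s' \<Longrightarrow> exec c s U u \<Longrightarrow> U = T \<and> u = s'"
proof (induction arbitrary: U u rule: exec.induct)
  case exec_Skip from exec_Skip.prems show ?case by cases auto
next
  case exec_IPut from exec_IPut.prems show ?case by cases auto
next
  case exec_RPut from exec_RPut.prems show ?case by cases auto
next
  case exec_Seq from exec_Seq.prems show ?case
    by cases (use exec_Seq.IH in blast)
next
  case exec_CondT from exec_CondT.prems show ?case
    by cases (use exec_CondT.hyps exec_CondT.IH in blast)+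
next
  case exec_CondF from exec_CondF.prems show ?case
    by cases (use exec_CondF.hyps exec_CondF.IH in blast)+
next
  case exec_WhileF from exec_WhileF.prems show ?case
    by cases (use exec_WhileF.hyps in blast)+
next
  case exec_WhileT from exec_WhileT.prems show ?case
    by cases (use exec_WhileT.hyps exec_WhileT.IH in blast)+
qed

section \<open>Input and output\<close>

text \<open>
  Only \<open>f 0, \<dots>, f k\<close> are part of the input; all unmentioned cells initially hold 0.
\<close>

definition input_store :: "nat \<Rightarrow> nat \<Rightarrow> real \<Rightarrow> (nat \<Rightarrow> real) \<Rightarrow> store" where
  "input_store m k p f =
     ((\<lambda>x js. if x = ''m'' \<and> js = [] then m
              else if x = ''k'' \<and> js = [] then k
              else 0),
      (\<lambda>x js. if x = ''p'' \<and> js = [] then p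
              else if x = ''f'' \<and> (\<exists>i\<le>k. js = [i]) then f (hd js)
              else 0))"

text \<open>
  A state \<open>(t, s, S, r)\<close>: the current candidate is \<open>c\<^sub>t\<close>, it is approved by the voters in \<open>S\<close>,
  and \<open>s\<close> candidates have been selected before, \<open>r i\<close> of which voter \<open>i\<close> approves.
\<close>

type_synonym pstate = "nat \<times> nat \<times> nat set \<times> (nat \<Rightarrow> nat)"

definition pstates :: "nat \<Rightarrow> nat \<Rightarrow> nat \<Rightarrow> pstate set" where
  "pstates n m k =
     {(t, s, S, r). t \<in> {1..m} \<and> s \<le> k \<and> S \<subseteq> {1..n} \<and> (\<forall>i\<in>{1..n}. r i \<le> k)}"

definition state_of :: "history \<Rightarrow> nat set \<Rightarrow> pstate" where
  "state_of h S =
     (Suc (length h), card (selected h), S, \<lambda>i. card {t \<in> selected h. i \<in> fst (h ! (t - 1))})"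

text \<open>The address \<open>(t, s, [1 \<in> S], \<dots>, [n \<in> S], r 1, \<dots>, r n)\<close> of a state in the table.\<close>

fun address :: "nat \<Rightarrow> pstate \<Rightarrow> nat list" where
  "address n (t, s, S, r) =
     [t, s] @ map (\<lambda>i. if i \<in> S then 1 else 0) [1..<Suc n] @ map r [1..<Suc n]"

text \<open>The output is the array \<open>''table''\<close>, where 1 stands for ``yes'' and 0 for ``no''.\<close>

definition policy_table :: "nat \<Rightarrow> nat \<Rightarrow> nat \<Rightarrow> store \<Rightarrow> bool" where
  "policy_table n m k s \<longleftrightarrow> (\<forall>q\<in>pstates n m k. fst s ''table'' (address n q) \<in> {0, 1})"

definition table_policy :: "nat \<Rightarrow> store \<Rightarrow> policy" where
  "table_policy n s h S \<longleftrightarrow> fst s ''table'' (address n (state_of h S)) = 1"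

end

theory Submission
  imports Defs
begin

text \<open>
  The score of a committee depends on a history only through the number of selected candidates
  and the number of selected candidates that each voter approves. The latter is a vector in
  \<open>{0, \<dots>, k}\<^sup>n\<close>, so for constant \<open>n\<close> there are polynomially many situations, and backward induction on
  the number of candidates still to come yields the best expected score in each of them. Safety
  means that a candidate may be rejected only if enough others are left to fill the committee.
  The approvals of the next candidate are independent of the past, so the expected score of any
  policy satisfies the corresponding recursion over histories, whose value is at most the optimal
  one, with equality for the policy that always takes the better option.
\<close>

section \<open>Backward induction\<close>

text \<open>Constant \<open>n\<close> enters through the program text: each \<open>n\<close> has its
  own program, with one loop and one address component per voter and the 2^n approver sets unrolled.
  This gives n + 2 nested loops around a body whose cost depends on \<open>n\<close> alone. Two
  mismatches shape the correctness proof. Tallies are total functions, while an address keeps only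
  the coordinates 1..n. And some cells are not guaranteed to hold the optimal value: those with s +
  u < k, where the committee can no longer be filled, and those with r i > s. They never influence a
  meaningful cell: selecting lowers u and raises s by one, rejecting is guarded by feasibility, and
  r i grows only together with s. Safety is demanded for all approvals, even those of probability 0,
  so the feasibility bound holds for every approver set and no conditioning on null events
  occurs.\<close>

definition subset_prob :: "nat \<Rightarrow> real \<Rightarrow> nat set \<Rightarrow> real" where
  "subset_prob n p S = (\<Prod>i\<in>{1..n}. if i \<in> S then p else 1 - p)"

definition add_votes :: "nat set \<Rightarrow> (nat \<Rightarrow> nat) \<Rightarrow> nat \<Rightarrow> nat" where
  "add_votes S r i = r i + (if i \<in> S then 1 else 0)"

definition final_score :: "nat \<Rightarrow> (nat \<Rightarrow> real) \<Rightarrow> (nat \<Rightarrow> nat) \<Rightarrow> real" where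
  "final_score n f r = (\<Sum>i\<in>{1..n}. f (r i))"

text \<open>
  The argument after \<open>f\<close> is the number of candidates still to come. Rejecting a candidate is
  possible only if the others suffice to fill the committee.
\<close>

primrec opt_value ::
  "nat \<Rightarrow> nat \<Rightarrow> real \<Rightarrow> (nat \<Rightarrow> real) \<Rightarrow> nat \<Rightarrow> nat \<Rightarrow> (nat \<Rightarrow> nat) \<Rightarrow> real" where
  "opt_value n k p f 0 s r = final_score n f r"
| "opt_value n k p f (Suc u) s r =
     (if s = k then final_score n f r
      else \<Sum>S\<in>Pow {1..n}. subset_prob n p S *
        (if k \<le> s + u \<and> opt_value n k p f u (Suc s) (add_votes S r) < opt_value n k p f u s r
         then opt_value n k p f u s r else opt_value n k p f u (Suc s) (add_votes S r)))"

definition rejects ::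
  "nat \<Rightarrow> nat \<Rightarrow> real \<Rightarrow> (nat \<Rightarrow> real) \<Rightarrow> nat \<Rightarrow> nat \<Rightarrow> (nat \<Rightarrow> nat) \<Rightarrow> nat set \<Rightarrow> bool" where
  "rejects n k p f u s r S \<longleftrightarrow>
     k \<le> s + u \<and> opt_value n k p f u (Suc s) (add_votes S r) < opt_value n k p f u s r"

lemma final_score_cong:
  "(\<And>i. i \<in> {1..n} \<Longrightarrow> r i = r' i) \<Longrightarrow> final_score n f r = final_score n f r'"
  by (simp add: final_score_def)

text \<open>Needed because memory determines a tally only on 1..n. \<open>add_votes\<close> acts
  coordinatewise, so agreement on 1..n survives the recursion.\<close>

lemma opt_value_cong:
  "(\<And>i. i \<in> {1..n} \<Longrightarrow> r i = r' i) \<Longrightarrow> opt_value n k p f u s r = opt_value n k p f u s r'"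
proof (induction u arbitrary: s r r')
  case 0
  then show ?case by (auto intro: final_score_cong)
next
  case (Suc u)
  have "opt_value n k p f u s r = opt_value n k p f u s r'" for s
    using Suc by blast
  moreover have "opt_value n k p f u s (add_votes S r) = opt_value n k p f u s (add_votes S r')" for s S
    by (rule Suc.IH) (simp add: add_votes_def Suc.prems)
  moreover have "final_score n f r = final_score n f r'"
    using Suc.prems by (rule final_score_cong)
  ultimately show ?case by (simp cong: if_cong)
qed

lemma rejects_cong:
  assumes "\<And>i. i \<in> {1..n} \<Longrightarrow> r i = r' i"
  shows "rejects n k p f u s r S \<longleftrightarrow> rejects n k p f u s r' S"
proof -
  have "opt_value n k p f u s r = opt_value n k p f u s r'"
    using assms by (rule opt_value_cong)
  moreover have "opt_value n k p f u (Suc s) (add_votes S r) = opt_value n k p f u (Suc s) (add_votes S r')"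
    by (rule opt_value_cong) (simp add: add_votes_def assms)
  ultimately show ?thesis by (simp add: rejects_def)
qed

lemma subset_prob_nonneg: "0 \<le> p \<Longrightarrow> p \<le> 1 \<Longrightarrow> 0 \<le> subset_prob n p S"
  unfolding subset_prob_def by (intro prod_nonneg) auto

section \<open>Histories\<close>

definition approval_counts :: "history \<Rightarrow> nat \<Rightarrow> nat" where
  "approval_counts h i = card {t \<in> selected h. i \<in> fst (h ! (t - 1))}"

lemma finite_selected [simp]: "finite (selected h)"
  by (simp add: selected_def)

lemma selected_Nil [simp]: "selected [] = {}"
  by (simp add: selected_def)

lemma selected_snoc:
  "selected (h @ [(S, a)]) = selected h \<union> (if a then {Suc (length h)} else {})"
  by (auto simp: selected_def nth_append le_Suc_eq split: if_splits)

lemma selected_bounds: "t \<in> selected h \<Longrightarrow> 1 \<le> t \<and> t \<le> length h"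
  by (auto simp: selected_def)

lemma card_selected_snoc:
  "card (selected (h @ [(S, a)])) = card (selected h) + (if a then 1 else 0)"
proof -
  have "Suc (length h) \<notin> selected h"
    using selected_bounds by fastforce
  then show ?thesis by (simp add: selected_snoc)
qed

lemma approval_counts_snoc:
  "approval_counts (h @ [(S, a)]) = (if a then add_votes S (approval_counts h) else approval_counts h)"
proof
  fix i
  let ?c = "\<lambda>h. {t \<in> selected h. i \<in> fst (h ! (t - 1))}"
  have nth: "(h @ [(S, a)]) ! (t - 1) = h ! (t - 1)" if "t \<in> selected h" for t
    using selected_bounds[OF that] by (auto simp: nth_append)
  have "?c (h @ [(S, a)]) = ?c h \<union> (if a \<and> i \<in> S then {Suc (length h)} else {})"
    using nth by (auto simp: selected_snoc split: if_splits)
  moreover have "Suc (length h) \<notin> ?c h"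
    using selected_bounds by fastforce
  moreover have "finite (?c h)" by simp
  ultimately show "approval_counts (h @ [(S, a)]) i =
      (if a then add_votes S (approval_counts h) else approval_counts h) i"
    by (simp add: approval_counts_def add_votes_def)
qed

lemma approval_counts_le: "approval_counts h i \<le> card (selected h)"
  unfolding approval_counts_def by (rule card_mono) auto

lemma approval_counts_Nil [simp]: "approval_counts [] = (\<lambda>i. 0)"
  by (rule ext) (simp add: approval_counts_def)

lemma state_of_eq:
  "state_of h S = (Suc (length h), card (selected h), S, approval_counts h)"
  by (simp add: state_of_def approval_counts_def fun_eq_iff)

section \<open>The expected score as a recursion over histories\<close>

text \<open>Plays the role of the conditional expected final score given \<open>h\<close>, but is
  defined for every history, also for those of probability 0. Terminal histories stop the recursion
  because \<open>play\<close> freezes them.\<close>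

primrec policy_value ::
  "nat \<Rightarrow> nat \<Rightarrow> nat \<Rightarrow> real \<Rightarrow> (nat \<Rightarrow> real) \<Rightarrow> policy \<Rightarrow> nat \<Rightarrow> history \<Rightarrow> real" where
  "policy_value n m k p f \<pi> 0 h = final_score n f (approval_counts h)"
| "policy_value n m k p f \<pi> (Suc u) h =
     (if terminal m k h then final_score n f (approval_counts h)
      else \<Sum>S\<in>Pow {1..n}. subset_prob n p S * policy_value n m k p f \<pi> u (h @ [(S, \<pi> h S)]))"

definition approvers_pmf :: "nat \<Rightarrow> real \<Rightarrow> nat set pmf" where
  "approvers_pmf n p = map_pmf (\<lambda>\<omega>. {i \<in> {1..n}. \<omega> i}) (Pi_pmf {1..n} False (\<lambda>_. bernoulli_pmf p))"

text \<open>Every sample in the support is False outside 1..n, so the restriction in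
  \<open>approvers_pmf\<close> is vacuous; as \<open>Collect\<close> is injective, the mass of a set
  is the product mass of its indicator.\<close>

lemma pmf_approvers:
  assumes "0 \<le> p" "p \<le> 1" "S \<subseteq> {1..n}"
  shows "pmf (approvers_pmf n p) S = subset_prob n p S"
proof -
  let ?M = "Pi_pmf {1..n} False (\<lambda>_. bernoulli_pmf p)"
  have "approvers_pmf n p = map_pmf Collect ?M"
    unfolding approvers_pmf_def
    by (rule map_pmf_cong[OF refl]) (use set_Pi_pmf_subset[of "{1..n}" False] in blast)
  then have "pmf (approvers_pmf n p) S = pmf (map_pmf Collect ?M) (Collect (\<lambda>i. i \<in> S))"
    by simp
  also have "\<dots> = pmf ?M (\<lambda>i. i \<in> S)"
    by (rule pmf_map_inj') (auto simp: inj_def)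
  also have "\<dots> = (\<Prod>i\<in>{1..n}. pmf (bernoulli_pmf p) (i \<in> S))"
    by (rule pmf_Pi') (use assms in auto)
  also have "\<dots> = subset_prob n p S"
    unfolding subset_prob_def using assms by (intro prod.cong) auto
  finally show ?thesis .
qed

lemma set_approvers_pmf: "set_pmf (approvers_pmf n p) \<subseteq> Pow {1..n}"
  by (auto simp: approvers_pmf_def)

lemma expectation_approvers:
  assumes "0 \<le> p" "p \<le> 1"
  shows "measure_pmf.expectation (approvers_pmf n p) g = (\<Sum>S\<in>Pow {1..n}. subset_prob n p S * g S)"
proof -
  have "measure_pmf.expectation (approvers_pmf n p) g =
      (\<Sum>S\<in>Pow {1..n}. pmf (approvers_pmf n p) S *\<^sub>R g S)"
    by (rule integral_measure_pmf) (use set_approvers_pmf[of n p] in auto)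
  also have "\<dots> = (\<Sum>S\<in>Pow {1..n}. subset_prob n p S * g S)"
    by (rule sum.cong) (auto simp: pmf_approvers[OF assms])
  finally show ?thesis .
qed

lemma play_cong:
  "(\<And>t. t \<in> {1..q} \<Longrightarrow> approvers n \<omega> t = approvers n \<omega>' t) \<Longrightarrow>
    play n m k \<pi> \<omega> q = play n m k \<pi> \<omega>' q"
proof (induction q)
  case (Suc q)
  then have "play n m k \<pi> \<omega> q = play n m k \<pi> \<omega>' q" by simp
  moreover have "approvers n \<omega> (Suc q) = approvers n \<omega>' (Suc q)" using Suc.prems by simp
  ultimately show ?case by (simp add: Let_def)
qed simp

lemma map_approvers_Pi_pmf:
  "map_pmf (\<lambda>\<omega>. approvers n \<omega> q) (Pi_pmf ({1..n} \<times> {q}) False (\<lambda>_. bernoulli_pmf p)) =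
    approvers_pmf n p"
proof -
  let ?h = "\<lambda>i. (i, q)"
  have "Pi_pmf {1..n} False (\<lambda>_. bernoulli_pmf p) =
      map_pmf (\<lambda>g. g \<circ> ?h) (Pi_pmf ({1..n} \<times> {q}) False (\<lambda>_. bernoulli_pmf p))"
    by (rule Pi_pmf_bij_betw) (auto simp: bij_betw_def inj_on_def)
  then show ?thesis
    by (simp add: approvers_pmf_def approvers_def map_pmf_comp o_def)
qed

text \<open>This is where independence enters. The first q columns of the profile and column
  \<open>Suc q\<close> are independent blocks; the history after q steps is a function of the
  former, the new approver set a function of the latter. Only the profile is truncated;
  \<open>m\<close> still governs \<open>terminal\<close>.\<close>

lemma play_pmf_Suc:
  "map_pmf (\<lambda>\<omega>. play n m k \<pi> \<omega> (Suc q)) (approvals_pmf n (Suc q) p) =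
   bind_pmf (map_pmf (\<lambda>\<omega>. play n m k \<pi> \<omega> q) (approvals_pmf n q p))
     (\<lambda>h. if terminal m k h then return_pmf h
          else map_pmf (\<lambda>S. h @ [(S, \<pi> h S)]) (approvers_pmf n p))"
proof -
  define A where "A = {1..n} \<times> {1..q}"
  define B where "B = {1..n} \<times> {Suc q}"
  define M where "M C = Pi_pmf C False (\<lambda>_. bernoulli_pmf p)" for C :: "(nat \<times> nat) set"
  define glue where "glue = (\<lambda>(g :: profile, g') x. if x \<in> A then g x else g' x)"
  define step where
    "step h S = (if terminal m k h then h else h @ [(S, \<pi> h S)])" for h S
  have "approvals_pmf n (Suc q) p = M (A \<union> B)"
    unfolding approvals_pmf_def M_def A_def B_def
    by (rule arg_cong[where f = "\<lambda>C. Pi_pmf C False (\<lambda>_. bernoulli_pmf p)"]) auto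
  also have "\<dots> = map_pmf glue (pair_pmf (M A) (M B))"
    unfolding M_def glue_def by (rule Pi_pmf_union) (auto simp: A_def B_def)
  finally have split: "approvals_pmf n (Suc q) p = map_pmf glue (pair_pmf (M A) (M B))" .
  have "approvers n (glue (g, g')) t = approvers n g t" if "t \<in> {1..q}" for g g' t
    using that by (auto simp: approvers_def glue_def A_def)
  then have old: "play n m k \<pi> (glue (g, g')) q = play n m k \<pi> g q" for g g'
    by (rule play_cong)
  have new: "approvers n (glue (g, g')) (Suc q) = approvers n g' (Suc q)" for g g'
    by (auto simp: approvers_def glue_def A_def)
  have play_glue: "play n m k \<pi> (glue x) (Suc q) =
      step (play n m k \<pi> (fst x) q) (approvers n (snd x) (Suc q))" for x
    by (cases x) (simp add: Let_def old new step_def)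
  have step_pmf: "map_pmf (step h) (approvers_pmf n p) =
      (if terminal m k h then return_pmf h
       else map_pmf (\<lambda>S. h @ [(S, \<pi> h S)]) (approvers_pmf n p))" for h
    by (simp add: step_def[abs_def] map_pmf_const)
  have base: "M A = approvals_pmf n q p"
    by (simp add: M_def A_def approvals_pmf_def)
  have "map_pmf (\<lambda>\<omega>. play n m k \<pi> \<omega> (Suc q)) (approvals_pmf n (Suc q) p) =
      map_pmf (\<lambda>x. step (play n m k \<pi> (fst x) q) (approvers n (snd x) (Suc q)))
        (pair_pmf (M A) (M B))"
    by (simp only: split map_pmf_comp play_glue)
  also have "\<dots> = bind_pmf (map_pmf (\<lambda>\<omega>. play n m k \<pi> \<omega> q) (M A))
      (\<lambda>h. map_pmf (step h) (map_pmf (\<lambda>\<omega>. approvers n \<omega> (Suc q)) (M B)))"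
    by (simp add: pair_pmf_def map_bind_pmf bind_map_pmf map_pmf_comp) (simp add: map_pmf_def)
  also have "map_pmf (\<lambda>\<omega>. approvers n \<omega> (Suc q)) (M B) = approvers_pmf n p"
    unfolding M_def B_def by (rule map_approvers_Pi_pmf)
  finally show ?thesis by (simp only: step_pmf base)
qed

lemma finite_set_approvals_pmf: "finite (set_pmf (approvals_pmf n q p))"
proof -
  let ?A = "{1..n} \<times> {1..q}"
  have "set_pmf (approvals_pmf n q p) \<subseteq> (\<lambda>X x. x \<in> X) ` Pow ?A"
  proof
    fix \<omega> assume "\<omega> \<in> set_pmf (approvals_pmf n q p)"
    then have "\<forall>x. x \<notin> ?A \<longrightarrow> \<not> \<omega> x"
      using set_Pi_pmf_subset[of ?A False] by (auto simp: approvals_pmf_def)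
    then have "Collect \<omega> \<in> Pow ?A" by blast
    moreover have "\<omega> = (\<lambda>x. x \<in> Collect \<omega>)" by simp
    ultimately show "\<omega> \<in> (\<lambda>X x. x \<in> X) ` Pow ?A" by blast
  qed
  then show ?thesis by (rule finite_subset) simp
qed

lemma policy_value_terminal:
  "terminal m k h \<Longrightarrow> policy_value n m k p f \<pi> u h = final_score n f (approval_counts h)"
  by (cases u) auto

text \<open>A martingale-type identity: averaging over one step of play turns \<open>u\<close>
  remaining candidates into \<open>Suc u\<close>, so q steps of play can be traded for q levels of
  recursion. With q = m and u = 0 the left side becomes the expected score.\<close>

lemma expectation_policy_value:
  assumes "0 \<le> p" "p \<le> 1"
  shows "measure_pmf.expectation (map_pmf (\<lambda>\<omega>. play n m k \<pi> \<omega> q) (approvals_pmf n q p))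
    (policy_value n m k p f \<pi> u) = policy_value n m k p f \<pi> (q + u) []"
proof (induction q arbitrary: u)
  case 0
  show ?case by simp
next
  case (Suc q)
  define P where "P = map_pmf (\<lambda>\<omega>. play n m k \<pi> \<omega> q) (approvals_pmf n q p)"
  define K where "K h = (if terminal m k h then return_pmf h
          else map_pmf (\<lambda>S. h @ [(S, \<pi> h S)]) (approvers_pmf n p))" for h
  have fin: "finite (set_pmf P)"
    by (simp add: P_def finite_set_approvals_pmf)
  have finK: "finite (set_pmf (K h))" for h
    using finite_subset[OF set_approvers_pmf[of n p]] by (simp add: K_def)
  have K: "measure_pmf.expectation (K h) (policy_value n m k p f \<pi> u) =
      policy_value n m k p f \<pi> (Suc u) h" for h
    by (simp add: K_def expectation_approvers[OF assms] policy_value_terminal)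
  have "measure_pmf.expectation (map_pmf (\<lambda>\<omega>. play n m k \<pi> \<omega> (Suc q)) (approvals_pmf n (Suc q) p))
      (policy_value n m k p f \<pi> u) =
      measure_pmf.expectation (bind_pmf P K) (policy_value n m k p f \<pi> u)"
    unfolding play_pmf_Suc P_def K_def ..
  also have "\<dots> = (\<Sum>h\<in>set_pmf P. pmf P h *\<^sub>R measure_pmf.expectation (K h) (policy_value n m k p f \<pi> u))"
    by (rule pmf_expectation_bind) (simp_all add: fin finK)
  also have "\<dots> = (\<Sum>h\<in>set_pmf P. pmf P h *\<^sub>R policy_value n m k p f \<pi> (Suc u) h)"
    by (simp only: K)
  also have "\<dots> = measure_pmf.expectation P (policy_value n m k p f \<pi> (Suc u))"
    by (rule integral_measure_pmf[symmetric]) (simp_all add: fin)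
  also have "\<dots> = policy_value n m k p f \<pi> (q + Suc u) []"
    unfolding P_def by (rule Suc.IH)
  finally show ?case by simp
qed

lemma play_length_nth:
  "length (play n m k \<pi> \<omega> q) \<le> q \<and>
   (\<forall>t < length (play n m k \<pi> \<omega> q). fst (play n m k \<pi> \<omega> q ! t) = approvers n \<omega> (Suc t))"
proof (induction q)
  case (Suc q)
  show ?case
  proof (cases "terminal m k (play n m k \<pi> \<omega> q) \<or> length (play n m k \<pi> \<omega> q) < q")
    case True
    \<comment> \<open>A history that is not frozen has length equal to its step number. So a shorter
      one is frozen, and otherwise the new entry lands at index q.\<close>
    have "terminal m k (play n m k \<pi> \<omega> q') \<or> length (play n m k \<pi> \<omega> q') = q'" for q'
      by (induction q') (auto simp: Let_def)
    with True have "terminal m k (play n m k \<pi> \<omega> q)" by fastforce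
    with Suc show ?thesis by (auto simp: Let_def)
  next
    case False
    with Suc show ?thesis by (auto simp: Let_def nth_append less_Suc_eq)
  qed
qed simp

text \<open>The score reads the profile, the tally reads the approver sets recorded in the history;
  they agree because entry t - 1 records the approvers of candidate t.\<close>

lemma thiele_score_play:
  "thiele_score f n m \<omega> (selected (play n m k \<pi> \<omega> m)) =
    final_score n f (approval_counts (play n m k \<pi> \<omega> m))"
proof -
  let ?h = "play n m k \<pi> \<omega> m"
  have "approved m \<omega> i \<inter> selected ?h = {t \<in> selected ?h. i \<in> fst (?h ! (t - 1))}"
    if i: "i \<in> {1..n}" for i
  proof -
    have "t \<in> approved m \<omega> i \<longleftrightarrow> i \<in> fst (?h ! (t - 1))" if "t \<in> selected ?h" for t
    proof -
      have t: "1 \<le> t" "t \<le> length ?h" using selected_bounds[OF that] by auto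
      then have "fst (?h ! (t - 1)) = approvers n \<omega> t"
        using play_length_nth[of n m k \<pi> \<omega> m] by (auto dest!: spec[of _ "t - 1"])
      moreover have "t \<le> m"
        using t play_length_nth[of n m k \<pi> \<omega> m] by simp
      ultimately show ?thesis using t i by (auto simp: approved_def approvers_def)
    qed
    then show ?thesis by blast
  qed
  then show ?thesis
    by (simp add: thiele_score_def final_score_def approval_counts_def)
qed

lemma expected_score_eq:
  assumes "0 \<le> p" "p \<le> 1"
  shows "expected_score n m k p f \<pi> = policy_value n m k p f \<pi> m []"
  using expectation_policy_value[OF assms, of n m k \<pi> m f 0]
  by (simp add: expected_score_def thiele_score_play)

section \<open>Optimality of backward induction\<close>

lemma induced_bounds:
  assumes "induced n m k \<pi> h"
  shows "card (selected h) \<le> k" "length h \<le> m"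
  using assms
  by (induction rule: induced.induct) (auto simp: terminal_def card_selected_snoc le_less)

text \<open>Continue \<open>h\<close> by candidates that nobody approves until the play ends. There
  safety gives exactly k, and the number of selected plus remaining candidates never increases on
  the way.\<close>

lemma safe_policy_feasible:
  assumes safe: "safe_policy n m k \<pi>" and "induced n m k \<pi> h"
  shows "k \<le> card (selected h) + (m - length h)"
  using assms(2)
proof (induction "m - length h" arbitrary: h rule: less_induct)
  case less
  show ?case
  proof (cases "terminal m k h")
    case True
    then show ?thesis using safe less.prems by (auto simp: safe_policy_def)
  next
    case False
    let ?h = "h @ [({}, \<pi> h {})]"
    have ind: "induced n m k \<pi> ?h" using less.prems False by (intro induced_snoc) auto
    have "length h < m"
      using False induced_bounds(2)[OF less.prems] by (auto simp: terminal_def)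
    then have "k \<le> card (selected ?h) + (m - length ?h)" by (intro less.hyps ind) simp
    also have "\<dots> \<le> card (selected h) + (m - length h)"
      using \<open>length h < m\<close> by (cases "\<pi> h {}") (auto simp: card_selected_snoc)
    finally show ?thesis .
  qed
qed

text \<open>Safety matters where \<open>\<pi>\<close> rejects: the extended history is still
  feasible, so \<open>opt_value\<close> admits rejection too and takes the larger of the two
  options.\<close>

lemma policy_value_le:
  assumes p: "0 \<le> p" "p \<le> 1" and safe: "safe_policy n m k \<pi>"
  shows "induced n m k \<pi> h \<Longrightarrow> length h + u = m \<Longrightarrow>
    policy_value n m k p f \<pi> u h \<le> opt_value n k p f u (card (selected h)) (approval_counts h)"
proof (induction u arbitrary: h)
  case (Suc u)
  show ?case
  proof (cases "terminal m k h")
    case True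
    then have "card (selected h) = k"
      using safe Suc.prems by (auto simp: safe_policy_def)
    with True show ?thesis by simp
  next
    case False
    then have neq: "card (selected h) \<noteq> k" by (simp add: terminal_def)
    have "policy_value n m k p f \<pi> u (h @ [(S, \<pi> h S)]) \<le>
        (if rejects n k p f u (card (selected h)) (approval_counts h) S
         then opt_value n k p f u (card (selected h)) (approval_counts h)
         else opt_value n k p f u (Suc (card (selected h))) (add_votes S (approval_counts h)))"
      if "S \<subseteq> {1..n}" for S
    proof -
      have ind: "induced n m k \<pi> (h @ [(S, \<pi> h S)])"
        using Suc.prems False that by (intro induced_snoc) auto
      note IH = Suc.IH[OF ind]
      note feasible = safe_policy_feasible[OF safe ind]
      show ?thesis
      proof (cases "\<pi> h S")
        case True
        with IH Suc.prems show ?thesis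
          by (auto simp: rejects_def card_selected_snoc approval_counts_snoc)
      next
        case False
        with IH feasible Suc.prems show ?thesis
          by (auto simp: rejects_def card_selected_snoc approval_counts_snoc)
      qed
    qed
    then show ?thesis
      using False neq
      by (auto intro!: sum_mono mult_left_mono subset_prob_nonneg p simp: rejects_def)
  qed
qed simp

text \<open>Agreement with \<open>rejects\<close> is demanded only in feasible situations with an
  unfilled committee, which is all the table guarantees. This suffices: starting from k <= m, the
  guard in \<open>rejects\<close> preserves feasibility, so the policy meets no other situation
  before its play is over.\<close>

lemma optimal_safe_policyI:
  assumes p: "0 \<le> p" "p \<le> 1" and "k \<le> m"
    and \<pi>: "\<And>h S u. length h + Suc u = m \<Longrightarrow> card (selected h) < k \<Longrightarrow>
      k \<le> card (selected h) + Suc u \<Longrightarrow> S \<subseteq> {1..n} \<Longrightarrow>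
      \<pi> h S \<longleftrightarrow> \<not> rejects n k p f u (card (selected h)) (approval_counts h) S"
  shows "optimal_safe_policy n m k p f \<pi>"
proof -
  have feasible: "k \<le> card (selected h) + (m - length h)" if "induced n m k \<pi> h" for h
    using that
  proof induction
    case induced_Nil
    then show ?case using \<open>k \<le> m\<close> by simp
  next
    case (induced_snoc h S)
    have "length h < m" "card (selected h) < k"
      using induced_bounds[OF induced_snoc.hyps(1)] induced_snoc.hyps(2)
      by (auto simp: terminal_def)
    moreover from this obtain u where u: "m = length h + Suc u"
      using less_iff_Suc_add by auto
    ultimately show ?case
      using \<pi>[of h u S] induced_snoc by (auto simp: card_selected_snoc rejects_def)
  qed
  have safe: "safe_policy n m k \<pi>"
    unfolding safe_policy_def
  proof (intro allI impI, elim conjE)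
    fix h assume "induced n m k \<pi> h" "terminal m k h"
    with feasible[of h] induced_bounds[of n m k \<pi> h] show "card (selected h) = k"
      by (auto simp: terminal_def)
  qed
  have value_eq: "policy_value n m k p f \<pi> u h =
      opt_value n k p f u (card (selected h)) (approval_counts h)"
    if "induced n m k \<pi> h" "length h + u = m" for u h
    using that
  proof (induction u arbitrary: h)
    case (Suc u)
    show ?case
    proof (cases "terminal m k h")
      case True
      then have "card (selected h) = k"
        using safe Suc.prems by (auto simp: safe_policy_def)
      with True show ?thesis by simp
    next
      case False
      then have less: "card (selected h) < k"
        using induced_bounds(1)[OF Suc.prems(1)] by (simp add: terminal_def)
      have "policy_value n m k p f \<pi> u (h @ [(S, \<pi> h S)]) =
          (if rejects n k p f u (card (selected h)) (approval_counts h) S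
           then opt_value n k p f u (card (selected h)) (approval_counts h)
           else opt_value n k p f u (Suc (card (selected h))) (add_votes S (approval_counts h)))"
        if "S \<subseteq> {1..n}" for S
      proof -
        have "induced n m k \<pi> (h @ [(S, \<pi> h S)])"
          using Suc.prems False that by (intro induced_snoc) auto
        moreover have "\<pi> h S \<longleftrightarrow> \<not> rejects n k p f u (card (selected h)) (approval_counts h) S"
          using feasible[OF Suc.prems(1)] Suc.prems less that by (intro \<pi>) auto
        ultimately show ?thesis
          using Suc.IH[of "h @ [(S, \<pi> h S)]"] Suc.prems
          by (auto simp: card_selected_snoc approval_counts_snoc)
      qed
      then show ?thesis
        using False less by (auto intro!: sum.cong simp: rejects_def)
    qed
  qed simp
  have "expected_score n m k p f \<pi>' \<le> expected_score n m k p f \<pi>" if "safe_policy n m k \<pi>'" for \<pi>'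
    using policy_value_le[OF p that induced_Nil, of m f] value_eq[OF induced_Nil, of m]
    by (simp add: expected_score_eq[OF p])
  with safe show ?thesis by (simp add: optimal_safe_policy_def)
qed

section \<open>Loop-free programs and bounded loops\<close>

primrec loop_free :: "com \<Rightarrow> bool" where
  "loop_free Skip \<longleftrightarrow> True"
| "loop_free (IPut x es a) \<longleftrightarrow> True"
| "loop_free (RPut x es a) \<longleftrightarrow> True"
| "loop_free (Seq c d) \<longleftrightarrow> loop_free c \<and> loop_free d"
| "loop_free (Cond b c d) \<longleftrightarrow> loop_free c \<and> loop_free d"
| "loop_free (While b c) \<longleftrightarrow> False"

text \<open>Charges both branches of \<open>Cond\<close>, so the bound does not depend on the store
  and is a constant for a fixed loop-free program.\<close>

primrec cost_bound :: "com \<Rightarrow> nat" where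
  "cost_bound Skip = 1"
| "cost_bound (IPut x es a) = 1 + sum_list (map icost es) + icost a"
| "cost_bound (RPut x es a) = 1 + sum_list (map icost es) + rcost a"
| "cost_bound (Seq c d) = cost_bound c + cost_bound d"
| "cost_bound (Cond b c d) = 1 + bcost b + cost_bound c + cost_bound d"
| "cost_bound (While b c) = 0"

text \<open>
  As in \<open>cost_bound\<close>, the last clause is a dummy: \<open>result\<close> is meant for loop-free programs only.
\<close>

primrec result :: "com \<Rightarrow> store \<Rightarrow> store" where
  "result Skip s = s"
| "result (IPut x es a) s = (upd (fst s) x (map (ival (fst s)) es) (ival (fst s) a), snd s)"
| "result (RPut x es a) s = (fst s, upd (snd s) x (map (ival (fst s)) es) (rval s a))"
| "result (Seq c d) s = result d (result c s)"
| "result (Cond b c d) s = (if bval s b then result c s else result d s)"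
| "result (While b c) s = s"

definition runs :: "com \<Rightarrow> store \<Rightarrow> nat \<Rightarrow> (store \<Rightarrow> bool) \<Rightarrow> bool" where
  "runs c s B Q \<longleftrightarrow> (\<exists>T s'. exec c s T s' \<and> T \<le> B \<and> Q s')"

lemma exec_result:
  "loop_free c \<Longrightarrow> \<exists>T. exec c s T (result c s) \<and> T \<le> cost_bound c"
proof (induction c arbitrary: s)
  case Skip
  then show ?case by (auto intro: exec_Skip)
next
  case (IPut x es a)
  then show ?case using exec_IPut[of x es a "fst s" "snd s"] by auto
next
  case (RPut x es a)
  then show ?case using exec_RPut[of x es a "fst s" "snd s"] by auto
next
  case (Seq c d)
  obtain T where T: "exec c s T (result c s)" "T \<le> cost_bound c"
    using Seq.IH(1)[of s] Seq.prems by auto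
  obtain U where U: "exec d (result c s) U (result d (result c s))" "U \<le> cost_bound d"
    using Seq.IH(2)[of "result c s"] Seq.prems by auto
  show ?case using exec_Seq[OF T(1) U(1)] T(2) U(2) by (intro exI[of _ "T + U"]) simp
next
  case (Cond b c d)
  show ?case
  proof (cases "bval s b")
    case True
    from Cond obtain T where "exec c s T (result c s)" "T \<le> cost_bound c" by fastforce
    then show ?thesis using exec_CondT[OF True] True
      by (intro exI[of _ "1 + bcost b + T"]) auto
  next
    case False
    from Cond obtain T where "exec d s T (result d s)" "T \<le> cost_bound d" by fastforce
    then show ?thesis using exec_CondF[OF False] False
      by (intro exI[of _ "1 + bcost b + T"]) auto
  qed
qed simp

lemma runs_loop_free: "loop_free c \<Longrightarrow> Q (result c s) \<Longrightarrow> runs c s (cost_bound c) Q"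
  unfolding runs_def using exec_result by blast

lemma cost_bound_pos: "loop_free c \<Longrightarrow> 1 \<le> cost_bound c"
  by (induction c) auto

text \<open>The counter lives in a cell with constant address, so it can be a scalar or one
  coordinate of an array. The limit itself is included in the range.\<close>

definition For :: "vname \<Rightarrow> nat list \<Rightarrow> vname \<Rightarrow> com \<Rightarrow> com" where
  "For x js y c =
     Seq (IPut x (map IConst js) (IConst 0))
       (While (ILe (IGet x (map IConst js)) (IGet y []))
         (Seq c (IPut x (map IConst js) (IAdd (IGet x (map IConst js)) (IConst 1)))))"

lemma ival_map_IConst [simp]: "map (ival I \<circ> IConst) js = js"
  by (simp add: map_idI)

lemma sum_list_icost_IConst [simp]: "sum_list (map (icost \<circ> IConst) js) = length js"
  by (induction js) auto

text \<open>\<open>M\<close> is a common bound on the limits of all loops, so that each nesting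
  level multiplies the budget by the same factor. The body must preserve the counter and establish
  the invariant for the store after the increment.\<close>

lemma runs_For:
  assumes body: "\<And>j I R. j \<le> N \<Longrightarrow> Inv j (I, R) \<Longrightarrow> I x js = j \<Longrightarrow>
      runs c (I, R) B (\<lambda>(I', R'). I' x js = j \<and> Inv (Suc j) (upd I' x js (Suc j), R'))"
    and bound: "\<And>j I R. Inv j (I, R) \<Longrightarrow> I y [] = N"
    and init: "Inv 0 (upd I x js 0, R)"
    and "length js \<le> 1" "N \<le> M" "1 \<le> B"
  shows "runs (For x js y c) (I, R) (24 * (M + 1) * B) (Inv (Suc N))"
proof -
  let ?b = "ILe (IGet x (map IConst js)) (IGet y [])"
  let ?inc = "IPut x (map IConst js) (IAdd (IGet x (map IConst js)) (IConst 1))"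
  let ?w = "While ?b (Seq c ?inc)"
  \<comment> \<open>With an address of length at most 1, a passed test costs at most 5 and the
    increment at most 6, hence 11; the final failing test costs at most 5.\<close>
  have loop: "\<exists>T s'. exec ?w (I, R) T s' \<and> T \<le> (Suc N - j) * (B + 11) + 5 \<and> Inv (Suc N) s'"
    if "j \<le> Suc N" "Inv j (I, R)" "I x js = j" for j I R
    using that
  proof (induction "Suc N - j" arbitrary: j I R)
    case 0
    then have "\<not> bval (I, R) ?b" using bound[of j I R] by (simp add: o_def)
    from exec_WhileF[OF this] 0 show ?case
      using assms(4) by (auto intro!: exI)
  next
    case (Suc d)
    then have "j \<le> N" by simp
    then have b: "bval (I, R) ?b" using bound Suc by (simp add: o_def)
    from body[OF \<open>j \<le> N\<close> Suc.prems(2,3)] obtain T s\<^sub>1 where "exec c (I, R) T s\<^sub>1" "T \<le> B"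
      and s\<^sub>1: "case s\<^sub>1 of (I', R') \<Rightarrow> I' x js = j \<and> Inv (Suc j) (upd I' x js (Suc j), R')"
      unfolding runs_def by blast
    then obtain I' R' where T: "exec c (I, R) T (I', R')" "T \<le> B" "I' x js = j"
      "Inv (Suc j) (upd I' x js (Suc j), R')"
      by (cases s\<^sub>1) auto
    have inc: "exec ?inc (I', R') (cost_bound ?inc) (upd I' x js (Suc j), R')"
      using exec_IPut[of x "map IConst js" "IAdd (IGet x (map IConst js)) (IConst 1)" I' R'] T(3)
      by (simp add: o_def)
    have "d = Suc N - Suc j" "Suc j \<le> Suc N" "upd I' x js (Suc j) x js = Suc j"
      using Suc.hyps(2) \<open>j \<le> N\<close> by (simp_all add: upd_def)
    from Suc.hyps(1)[OF this(1,2) T(4) this(3)]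
    obtain U s' where U: "exec ?w (upd I' x js (Suc j), R') U s'"
      "U \<le> (Suc N - Suc j) * (B + 11) + 5" "Inv (Suc N) s'"
      by blast
    note ex = exec_WhileT[OF b exec_Seq[OF T(1) inc] U(1)]
    have "Suc N - j = Suc (Suc N - Suc j)" using \<open>j \<le> N\<close> by simp
    then have "(Suc N - j) * (B + 11) + 5 = (B + 11) + ((Suc N - Suc j) * (B + 11) + 5)"
      by simp
    then have "1 + bcost ?b + (T + cost_bound ?inc) + U \<le> (Suc N - j) * (B + 11) + 5"
      using U(2) T(2) assms(4) by (simp add: o_def sum_list_triv)
    with ex U(3) show ?case by blast
  qed
  obtain T s' where T: "exec ?w (upd I x js 0, R) T s'"
    "T \<le> Suc N * (B + 11) + 5" "Inv (Suc N) s'"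
    using loop[OF _ init] by (auto simp: upd_def)
  have init': "exec (IPut x (map IConst js) (IConst 0)) (I, R) (2 + length js) (upd I x js 0, R)"
    using exec_IPut[of x "map IConst js" "IConst 0" I R] by (simp add: o_def sum_list_triv)
  have iterations: "Suc N * b + 8 \<le> (M + 2) * b" if "8 \<le> b" for b
    using mult_le_mono1[OF \<open>N \<le> M\<close>, of b] that by (simp only: mult_Suc add_mult_distrib)
  \<comment> \<open>Initialisation costs at most 3, which with the failing test gives 8. The factor
    24 is 2 * 12, from M + 2 <= 2 * (M + 1) and B + 11 <= 12 * B.\<close>
  have "2 + length js + T \<le> Suc N * (B + 11) + 8"
    using T(2) assms(4) by linarith
  also have "\<dots> \<le> (M + 2) * (B + 11)"
    by (rule iterations) simp
  also have "\<dots> \<le> (2 * (M + 1)) * (12 * B)"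
    using \<open>1 \<le> B\<close> by (intro mult_mono) auto
  finally have "2 + length js + T \<le> 24 * (M + 1) * B" by (simp add: algebra_simps)
  then show ?thesis
    unfolding runs_def For_def using exec_Seq[OF init' T(1)] T(3) by blast
qed

lemma runs_mono: "runs c s B Q \<Longrightarrow> (\<And>s'. Q s' \<Longrightarrow> Q' s') \<Longrightarrow> runs c s B Q'"
  unfolding runs_def by blast

text \<open>One loop per voter, the highest index outermost. The counters are the cells of
  \<open>''r''\<close>, so together they form the current tally.\<close>

primrec nest :: "vname \<Rightarrow> nat \<Rightarrow> com \<Rightarrow> com" where
  "nest y 0 c = c"
| "nest y (Suc i) c = For ''r'' [Suc i] y (nest y i c)"

text \<open>\<open>Good r\<close> says that the work for tally \<open>r\<close> is done: it
  persists, and the body makes it true for the tally in memory. \<open>Ctx\<close> is what the body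
  relies on. Both must ignore \<open>''r''\<close>, which the counters overwrite.\<close>

lemma runs_nest:
  fixes Ctx :: "store \<Rightarrow> bool" and Good :: "(nat \<Rightarrow> nat) \<Rightarrow> store \<Rightarrow> bool"
  assumes body: "\<And>I R. Ctx (I, R) \<Longrightarrow> (\<And>j. j \<in> {1..n} \<Longrightarrow> I ''r'' [j] \<le> N) \<Longrightarrow>
      runs c (I, R) B (\<lambda>(I', R'). Ctx (I', R') \<and> I' ''r'' = I ''r'' \<and>
        (\<forall>r. (\<forall>j\<in>{1..n}. r j = I ''r'' [j]) \<longrightarrow> Good r (I', R')) \<and>
        (\<forall>r. Good r (I, R) \<longrightarrow> Good r (I', R')))"
    and Ctx_upd: "\<And>I R js v. Ctx (upd I ''r'' js v, R) = Ctx (I, R)"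
    and Good_upd: "\<And>r I R js v. Good r (upd I ''r'' js v, R) = Good r (I, R)"
    and bound: "\<And>I R. Ctx (I, R) \<Longrightarrow> I y [] = N"
    and "N \<le> M" "1 \<le> B"
  shows "i \<le> n \<Longrightarrow> Ctx (I, R) \<Longrightarrow> (\<And>j. j \<in> {i<..n} \<Longrightarrow> I ''r'' [j] \<le> N) \<Longrightarrow>
    runs (nest y i c) (I, R) ((24 * (M + 1)) ^ i * B) (\<lambda>(I', R'). Ctx (I', R') \<and>
      (\<forall>j>i. I' ''r'' [j] = I ''r'' [j]) \<and>
      (\<forall>r. (\<forall>j\<in>{1..i}. r j \<le> N) \<and> (\<forall>j\<in>{i<..n}. r j = I ''r'' [j]) \<longrightarrow> Good r (I', R')) \<and>
      (\<forall>r. Good r (I, R) \<longrightarrow> Good r (I', R')))"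
proof (induction i arbitrary: I R)
  case 0
  show ?case
    by (simp, rule runs_mono[OF body]) (use 0 in \<open>auto simp: Suc_le_eq\<close>)
next
  case (Suc i)
  \<comment> \<open>Before round v on coordinate \<open>Suc i\<close>, the tallies with a smaller
    value there are done; the inner loops then add those with value exactly v.\<close>
  define Inv where "Inv v = (\<lambda>(I', R'). Ctx (I', R') \<and>
      (\<forall>j>Suc i. I' ''r'' [j] = I ''r'' [j]) \<and>
      (\<forall>r. (\<forall>j\<in>{1..i}. r j \<le> N) \<and> r (Suc i) < v \<and> (\<forall>j\<in>{Suc i<..n}. r j = I ''r'' [j]) \<longrightarrow>
        Good r (I', R')) \<and>
      (\<forall>r. Good r (I, R) \<longrightarrow> Good r (I', R')))" for v
  have "runs (For ''r'' [Suc i] y (nest y i c)) (I, R)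
      (24 * (M + 1) * ((24 * (M + 1)) ^ i * B)) (Inv (Suc N))"
  proof (rule runs_For[where N = N])
    fix v J R'
    assume v: "v \<le> N" and inv: "Inv v (J, R')" and cell: "J ''r'' [Suc i] = v"
    have le: "J ''r'' [j] \<le> N" if "j \<in> {i<..n}" for j
    proof (cases "j = Suc i")
      case False
      with that have "j \<in> {Suc i<..n}" by auto
      then show ?thesis using inv Suc.prems(3)[of j] by (auto simp: Inv_def)
    qed (use v cell in simp)
    have ctx: "Ctx (J, R')" using inv by (simp add: Inv_def)
    show "runs (nest y i c) (J, R') ((24 * (M + 1)) ^ i * B)
      (\<lambda>(I', R'). I' ''r'' [Suc i] = v \<and> Inv (Suc v) (upd I' ''r'' [Suc i] (Suc v), R'))"
    proof (rule runs_mono[OF Suc.IH[OF _ ctx le]], goal_cases)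
      case (3 s')
      obtain I' R'' where s': "s' = (I', R'')" by (cases s')
      have new: "Good r (I', R'')"
        if r: "\<forall>j\<in>{1..i}. r j \<le> N" "r (Suc i) < Suc v" "\<forall>j\<in>{Suc i<..n}. r j = I ''r'' [j]" for r
      proof (cases "r (Suc i) = v")
        case True
        have "r j = J ''r'' [j]" if "j \<in> {i<..n}" for j
        proof (cases "j = Suc i")
          case False
          with that have "j \<in> {Suc i<..n}" by auto
          then show ?thesis using r(3) inv by (auto simp: Inv_def)
        qed (use True cell in simp)
        with r(1) 3 show ?thesis by (auto simp: s')
      next
        case False
        with r have "Good r (J, R')" using inv by (auto simp: Inv_def)
        with 3 show ?thesis by (auto simp: s')
      qed
      have "Ctx (I', R'')" and keep: "\<forall>j>i. I' ''r'' [j] = J ''r'' [j]"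
        and "\<forall>r. Good r (I, R) \<longrightarrow> Good r (I', R'')"
        using 3 inv by (simp_all add: s' Inv_def)
      moreover have "\<forall>j>Suc i. upd I' ''r'' [Suc i] (Suc v) ''r'' [j] = I ''r'' [j]"
        using keep inv by (simp add: Inv_def upd_def)
      ultimately show ?case
        using new keep cell by (simp add: s' Inv_def Ctx_upd Good_upd)
    qed (use Suc.prems in auto)
  next
    show "1 \<le> (24 * (M + 1)) ^ i * B" using \<open>1 \<le> B\<close> by simp
  next
    show "Inv 0 (upd I ''r'' [Suc i] 0, R)"
      using Suc.prems by (auto simp: Inv_def Ctx_upd Good_upd) (auto simp: upd_def)
  qed (use bound \<open>N \<le> M\<close> in \<open>auto simp: Inv_def\<close>)
  then have "runs (nest y (Suc i) c) (I, R) ((24 * (M + 1)) ^ Suc i * B) (Inv (Suc N))"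
    by (simp add: mult.assoc)
  then show ?case
    by (rule runs_mono) (auto simp: Inv_def less_Suc_eq_le atLeastAtMostSuc_conv)
qed

section \<open>The dynamic program\<close>

declare upt_Suc [simp del]

text \<open>
  The scalars \<open>''u''\<close> and \<open>''s''\<close> hold the number of candidates still to come and the number of
  selected ones; \<open>''V''\<close> stores the values of \<open>opt_value\<close>. The loops over the sets of approving
  voters are unrolled, since \<open>n\<close> is fixed.
\<close>

definition tally_exps :: "nat \<Rightarrow> nat set \<Rightarrow> iexp list" where
  "tally_exps n S =
     map (\<lambda>i. IAdd (IGet ''r'' [IConst i]) (IConst (if i \<in> S then 1 else 0))) [1..<Suc n]"

definition prob_exp :: "nat \<Rightarrow> nat set \<Rightarrow> rexp" where
  "prob_exp n S = foldr (\<lambda>i. RMul (if i \<in> S then RGet ''p'' [] else RSub ROne (RGet ''p'' [])))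
     [1..<Suc n] ROne"

definition score_exp :: "nat \<Rightarrow> rexp" where
  "score_exp n = foldr (\<lambda>i. RAdd (RGet ''f'' [IGet ''r'' [IConst i]])) [1..<Suc n] RZero"

definition reject_value :: "nat \<Rightarrow> rexp" where
  "reject_value n = RGet ''V'' (ISub (IGet ''u'' []) (IConst 1) # IGet ''s'' [] # tally_exps n {})"

definition select_value :: "nat \<Rightarrow> nat set \<Rightarrow> rexp" where
  "select_value n S = RGet ''V''
     (ISub (IGet ''u'' []) (IConst 1) # IAdd (IGet ''s'' []) (IConst 1) # tally_exps n S)"

text \<open>\<open>''u''\<close> counts the current candidate too, so the arrival time of that
  candidate is m + 1 - u. \<open>''acc''\<close> collects the expectation over approver
  sets.\<close>

definition record_choice :: "nat \<Rightarrow> nat set \<Rightarrow> nat \<Rightarrow> rexp \<Rightarrow> com" where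
  "record_choice n S a v = Seq
     (IPut ''table'' (ISub (IAdd (IGet ''m'' []) (IConst 1)) (IGet ''u'' []) # IGet ''s'' [] #
        map (\<lambda>i. IConst (if i \<in> S then 1 else 0)) [1..<Suc n] @ tally_exps n {}) (IConst a))
     (RPut ''acc'' [] (RAdd (RGet ''acc'' []) (RMul (prob_exp n S) v)))"

text \<open>For u = 0 the truncated subtraction reads a meaningless layer. With s < k such a state
  is infeasible, and \<open>solved\<close> claims nothing about it.\<close>

definition decide :: "nat \<Rightarrow> nat set \<Rightarrow> com" where
  "decide n S =
     Cond (BAnd (ILe (IGet ''k'' []) (IAdd (IGet ''s'' []) (ISub (IGet ''u'' []) (IConst 1))))
                (BNot (RLe (reject_value n) (select_value n S))))
       (record_choice n S 0 (reject_value n)) (record_choice n S 1 (select_value n S))"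

definition decide_all :: "nat \<Rightarrow> nat set list \<Rightarrow> com" where
  "decide_all n Ss = foldr (\<lambda>S. Seq (decide n S)) Ss Skip"

definition put_value :: "nat \<Rightarrow> rexp \<Rightarrow> com" where
  "put_value n = RPut ''V'' (IGet ''u'' [] # IGet ''s'' [] # tally_exps n {})"

text \<open>The loop keeps s <= k, so the test means s = k. This also covers the base case: with u =
  0 a state is feasible only if the committee is full.\<close>

definition body :: "nat \<Rightarrow> com" where
  "body n = Cond (ILe (IGet ''k'' []) (IGet ''s'' []))
     (put_value n (score_exp n))
     (Seq (RPut ''acc'' [] RZero)
       (Seq (decide_all n (map set (subseqs [1..<Suc n]))) (put_value n (RGet ''acc'' []))))"

text \<open>Tally coordinates run up to s rather than k: selecting may raise a coordinate by one,
  but then s rises as well, so the successor is again a computed cell. Both successors lie in the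
  earlier layer u - 1.\<close>

definition dynamic_program :: "nat \<Rightarrow> com" where
  "dynamic_program n = For ''u'' [] ''m'' (For ''s'' [] ''k'' (nest ''s'' n (body n)))"

lemma loop_free_body: "loop_free (body n)"
proof -
  have "loop_free (decide_all n Ss)" for Ss
    by (induction Ss) (simp_all add: decide_all_def decide_def record_choice_def)
  then show ?thesis by (simp add: body_def put_value_def)
qed

section \<open>Semantics of the unrolled expressions and decisions\<close>

lemma add_votes_empty [simp]: "add_votes {} r = r"
  by (simp add: add_votes_def fun_eq_iff)

lemma ival_tally_exps:
  assumes "\<And>i. i \<in> {1..n} \<Longrightarrow> I ''r'' [i] = r i"
  shows "map (ival I) (tally_exps n S) = map (add_votes S r) [1..<Suc n]"
  using assms by (simp add: tally_exps_def add_votes_def)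

lemma rval_prob_exp:
  assumes "snd st ''p'' [] = p"
  shows "rval st (prob_exp n S) = subset_prob n p S"
proof -
  have "rval st (foldr (\<lambda>i. RMul (if i \<in> S then RGet ''p'' [] else RSub ROne (RGet ''p'' []))) xs ROne)
      = (\<Prod>i\<leftarrow>xs. if i \<in> S then p else 1 - p)" for xs
    using assms by (induction xs) simp_all
  then show ?thesis
    by (simp add: prob_exp_def subset_prob_def prod.distinct_set_conv_list[symmetric]
        atLeastLessThanSuc_atLeastAtMost)
qed

lemma rval_score_exp:
  assumes "\<And>i. i \<in> {1..n} \<Longrightarrow> fst st ''r'' [i] = r i \<and> snd st ''f'' [r i] = f (r i)"
  shows "rval st (score_exp n) = final_score n f r"
proof -
  have "rval st (foldr (\<lambda>i. RAdd (RGet ''f'' [IGet ''r'' [IConst i]])) xs RZero) = (\<Sum>i\<leftarrow>xs. f (r i))"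
    if "set xs \<subseteq> {1..n}" for xs
    using that assms by (induction xs) auto
  then have "rval st (score_exp n) = (\<Sum>i\<leftarrow>[1..<Suc n]. f (r i))"
    by (simp add: score_exp_def atLeastLessThanSuc_atLeastAtMost)
  then show ?thesis
    by (simp add: final_score_def sum.distinct_set_conv_list[symmetric]
        atLeastLessThanSuc_atLeastAtMost)
qed

text \<open>This keeps entries of different states from overwriting each other; approvers and
  tallies outside 1..n leave no trace in memory.\<close>

lemma address_eq_iff:
  "address n (t, s, S, r) = address n (t', s', S', r') \<longleftrightarrow>
    t = t' \<and> s = s' \<and> (\<forall>i\<in>{1..n}. (i \<in> S \<longleftrightarrow> i \<in> S') \<and> r i = r' i)"
  by (auto simp: list_eq_iff_nth_eq[of "map f xs" "map g xs" for f g xs] split: if_splits)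

lemma address_cong: "(\<And>i. i \<in> {1..n} \<Longrightarrow> r i = r' i) \<Longrightarrow> address n (t, s, S, r) = address n (t, s, S, r')"
  by (simp only: address_eq_iff) simp

text \<open>\<open>N\<close> and \<open>Y\<close> are raw reads of \<open>V\<close>, not optimal
  values, so the effect of the code is described even where \<open>V\<close> is meaningless. Their
  meaning is supplied in \<open>result_body\<close>.\<close>

lemma result_decide_all:
  fixes n :: nat and V :: "nat list \<Rightarrow> real"
  defines "N \<equiv> \<lambda>u s r. V ((u - 1) # s # map r [1..<Suc n])"
    and "Y \<equiv> \<lambda>u s r S. V ((u - 1) # Suc s # map (add_votes S r) [1..<Suc n])"
  defines "rej \<equiv> \<lambda>k u s r S. k \<le> s + (u - 1) \<and> \<not> N u s r \<le> Y u s r S"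
  assumes "set Ss \<subseteq> Pow {1..n}"
    and "I ''m'' [] = m" "I ''k'' [] = k" "I ''u'' [] = u" "I ''s'' [] = s"
    and "\<And>i. i \<in> {1..n} \<Longrightarrow> I ''r'' [i] = r i" and "R ''p'' [] = p" "R ''V'' = V"
    and "result (decide_all n Ss) (I, R) = (I', R')"
  shows "(\<forall>x. x \<noteq> ''table'' \<longrightarrow> I' x = I x) \<and> (\<forall>x. x \<noteq> ''acc'' \<longrightarrow> R' x = R x) \<and>
    (\<forall>S\<in>set Ss. I' ''table'' (address n (m + 1 - u, s, S, r)) = (if rej k u s r S then 0 else 1)) \<and>
    (\<forall>js. js \<notin> (\<lambda>S. address n (m + 1 - u, s, S, r)) ` set Ss \<longrightarrow> I' ''table'' js = I ''table'' js) \<and>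
    R' ''acc'' [] = R ''acc'' [] +
      (\<Sum>S\<leftarrow>Ss. subset_prob n p S * (if rej k u s r S then N u s r else Y u s r S))"
  using assms(4-)
proof (induction Ss arbitrary: I R)
  case Nil
  then show ?case by (simp add: decide_all_def)
next
  case (Cons S Ss)
  let ?a = "\<lambda>S. address n (m + 1 - u, s, S, r)"
  let ?v = "if rej k u s r S then N u s r else Y u s r S"
  define I\<^sub>1 where "I\<^sub>1 = upd I ''table'' (?a S) (if rej k u s r S then 0 else 1)"
  define R\<^sub>1 where "R\<^sub>1 = upd R ''acc'' [] (R ''acc'' [] + subset_prob n p S * ?v)"
  have tally: "map (ival I) (tally_exps n {}) = map r [1..<Suc n]"
    using ival_tally_exps[of n I r "{}"] Cons.prems by simp
  \<comment> \<open>\<open>record_choice\<close> writes to the table before it evaluates the value,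
    so the evaluation has to be insensitive to \<open>''table''\<close>.\<close>
  have reject: "rval (J, R) (reject_value n) = N u s r" if "\<And>x. x \<noteq> ''table'' \<Longrightarrow> J x = I x" for J
    using ival_tally_exps[of n J r "{}"] Cons.prems that by (simp add: reject_value_def N_def)
  have select: "rval (J, R) (select_value n S) = Y u s r S" if "\<And>x. x \<noteq> ''table'' \<Longrightarrow> J x = I x" for J
    using ival_tally_exps[of n J r S] Cons.prems that by (simp add: select_value_def Y_def)
  have prob: "rval (J, R) (prob_exp n S) = subset_prob n p S" for J
    using Cons.prems by (intro rval_prob_exp) simp
  have bits: "map (ival I) (map (\<lambda>i. IConst (if i \<in> S then 1 else 0)) xs) =
      map (\<lambda>i. if i \<in> S then 1 else 0) xs" for xs
    by simp
  have record_choice: "result (record_choice n S a v) (I, R) =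
      (upd I ''table'' (?a S) a, upd R ''acc'' [] (R ''acc'' [] + subset_prob n p S * w))"
    if "\<And>J. (\<And>x. x \<noteq> ''table'' \<Longrightarrow> J x = I x) \<Longrightarrow> rval (J, R) v = w" for a v w
    using Cons.prems that[of "upd I ''table'' (?a S) a"]
    by (simp add: record_choice_def tally prob bits del: map_map) (simp add: upd_def)
  have "result (decide n S) (I, R) = (I\<^sub>1, R\<^sub>1)"
    using record_choice[OF reject, of 0] record_choice[OF select, of 1] reject[of I] select[of I] Cons.prems
    by (auto simp: decide_def I\<^sub>1_def R\<^sub>1_def rej_def)
  then have res: "result (decide_all n Ss) (I\<^sub>1, R\<^sub>1) = (I', R')"
    using Cons.prems(9) by (simp add: decide_all_def)
  have other: "I\<^sub>1 x = I x" if "x \<noteq> ''table''" for x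
    using that by (simp add: I\<^sub>1_def upd_def)
  have otherR: "R\<^sub>1 x = R x" if "x \<noteq> ''acc''" for x
    using that by (simp add: R\<^sub>1_def upd_def)
  have table: "I\<^sub>1 ''table'' js = (if js = ?a S then if rej k u s r S then 0 else 1 else I ''table'' js)" for js
    by (simp add: I\<^sub>1_def upd_def)
  have acc: "R\<^sub>1 ''acc'' [] = R ''acc'' [] + subset_prob n p S * ?v"
    by (simp add: R\<^sub>1_def upd_def)
  have IH: "(\<forall>x. x \<noteq> ''table'' \<longrightarrow> I' x = I\<^sub>1 x) \<and> (\<forall>x. x \<noteq> ''acc'' \<longrightarrow> R' x = R\<^sub>1 x) \<and>
    (\<forall>S\<in>set Ss. I' ''table'' (?a S) = (if rej k u s r S then 0 else 1)) \<and>
    (\<forall>js. js \<notin> ?a ` set Ss \<longrightarrow> I' ''table'' js = I\<^sub>1 ''table'' js) \<and>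
    R' ''acc'' [] = R\<^sub>1 ''acc'' [] +
      (\<Sum>S\<leftarrow>Ss. subset_prob n p S * (if rej k u s r S then N u s r else Y u s r S))"
    using Cons.prems by (intro Cons.IH res) (simp_all add: other otherR)
  \<comment> \<open>\<open>S\<close> may recur in the tail. Subsets of 1..n with equal addresses are
    equal, so a later write to this cell repeats the same action.\<close>
  have "I' ''table'' (?a S) = (if rej k u s r S then 0 else 1)"
  proof (cases "?a S \<in> ?a ` set Ss")
    case True
    then obtain S' where S': "S' \<in> set Ss" "?a S = ?a S'" by blast
    then have "\<forall>i\<in>{1..n}. i \<in> S \<longleftrightarrow> i \<in> S'"
      unfolding address_eq_iff by blast
    moreover have "S \<subseteq> {1..n}" "S' \<subseteq> {1..n}"
      using S'(1) Cons.prems(1) by auto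
    ultimately have "S = S'" by blast
    with S' IH show ?thesis by blast
  next
    case False
    with IH have "I' ''table'' (?a S) = I\<^sub>1 ''table'' (?a S)" by blast
    then show ?thesis by (simp only: table) simp
  qed
  moreover have "I' ''table'' js = I ''table'' js" if "js \<notin> ?a ` set (S # Ss)" for js
  proof -
    have "I' ''table'' js = I\<^sub>1 ''table'' js" "js \<noteq> ?a S" using that IH by auto
    then show ?thesis by (simp only: table) simp
  qed
  ultimately show ?case using IH by (simp add: other otherR acc del: address.simps)
qed

text \<open>The guard leaves infeasible cells unspecified. Actions are claimed only for s < k;
  feasibility then gives u > 0, so \<open>u - 1\<close> is the number of candidates after the
  current one.\<close>

definition solved ::
  "nat \<Rightarrow> nat \<Rightarrow> nat \<Rightarrow> real \<Rightarrow> (nat \<Rightarrow> real) \<Rightarrow> nat \<Rightarrow> nat \<Rightarrow> (nat \<Rightarrow> nat) \<Rightarrow> store \<Rightarrow> bool" where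
  "solved n m k p f u s r st \<longleftrightarrow> (k \<le> s + u \<longrightarrow>
     snd st ''V'' (u # s # map r [1..<Suc n]) = opt_value n k p f u s r \<and>
     (s < k \<longrightarrow> (\<forall>S\<subseteq>{1..n}. fst st ''table'' (address n (m + 1 - u, s, S, r)) =
        (if rejects n k p f (u - 1) s r S then 0 else 1))))"

lemma solved_cong:
  assumes "\<And>i. i \<in> {1..n} \<Longrightarrow> r i = r' i"
  shows "solved n m k p f u s r st = solved n m k p f u s r' st"
proof -
  have "map r [1..<Suc n] = map r' [1..<Suc n]"
    using assms by simp
  moreover have "opt_value n k p f u s r = opt_value n k p f u s r'"
    using assms by (rule opt_value_cong)
  moreover have "rejects n k p f (u - 1) s r S = rejects n k p f (u - 1) s r' S" for S
    using assms by (rule rejects_cong)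
  moreover have "address n (m + 1 - u, s, S, r) = address n (m + 1 - u, s, S, r')" for S
    using assms by (rule address_cong)
  ultimately show ?thesis by (simp only: solved_def)
qed

text \<open>The last conjunct concerns the output: table cells start at 0 and receive only 0 or 1,
  so entries that are never written are valid actions as well.\<close>

definition input_intact :: "nat \<Rightarrow> nat \<Rightarrow> real \<Rightarrow> (nat \<Rightarrow> real) \<Rightarrow> store \<Rightarrow> bool" where
  "input_intact m k p f st \<longleftrightarrow> fst st ''m'' [] = m \<and> fst st ''k'' [] = k \<and> snd st ''p'' [] = p \<and>
     (\<forall>j\<le>k. snd st ''f'' [j] = f j) \<and> (\<forall>js. fst st ''table'' js \<in> {0, 1})"

text \<open>\<open>r i \<le> s\<close> holds in every state that can occur; other entries are never computed.\<close>

definition solved_before ::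
  "nat \<Rightarrow> nat \<Rightarrow> nat \<Rightarrow> real \<Rightarrow> (nat \<Rightarrow> real) \<Rightarrow> nat \<Rightarrow> nat \<Rightarrow> store \<Rightarrow> bool" where
  "solved_before n m k p f u s st \<longleftrightarrow>
     (\<forall>u' s' r. (u' < u \<and> s' \<le> k \<or> u' = u \<and> s' < s) \<and> (\<forall>i\<in>{1..n}. r i \<le> s') \<longrightarrow>
        solved n m k p f u' s' r st)"

text \<open>Layer u - 1 supplies both successor values of the cell (u, s, r). Cells solved earlier
  survive because they are stored at other addresses, or are this very cell.\<close>

lemma result_body:
  assumes u: "I ''u'' [] = u" "u \<le> m" and s: "I ''s'' [] = s" "s \<le> k"
    and r: "\<forall>i\<in>{1..n}. I ''r'' [i] = r i" "\<forall>i\<in>{1..n}. r i \<le> s"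
    and intact: "input_intact m k p f (I, R)"
    and before: "solved_before n m k p f u s (I, R)"
    and res: "result (body n) (I, R) = (I', R')"
  shows "\<And>x. x \<noteq> ''table'' \<Longrightarrow> I' x = I x"
    and "input_intact m k p f (I', R')"
    and "solved n m k p f u s r (I', R')"
    and "\<And>u' s' r'. solved n m k p f u' s' r' (I, R) \<Longrightarrow> u' \<le> m \<Longrightarrow>
      solved n m k p f u' s' r' (I', R')"
proof -
  let ?js = "u # s # map r [1..<Suc n]"
  let ?a = "\<lambda>S. address n (m + 1 - u, s, S, r)"
  have tally: "map (ival J) (tally_exps n {}) = map r [1..<Suc n]" if "J ''r'' = I ''r''" for J
    using ival_tally_exps[of n J r "{}"] r that by simp
  have input: "I ''m'' [] = m" "I ''k'' [] = k" "R ''p'' [] = p" "\<And>j. j \<le> k \<Longrightarrow> R ''f'' [j] = f j"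
    "\<And>js. I ''table'' js \<in> {0, 1}"
    using intact by (auto simp: input_intact_def)
  have main: "(\<forall>x. x \<noteq> ''table'' \<longrightarrow> I' x = I x) \<and> (\<forall>js. I' ''table'' js \<in> {0, 1}) \<and>
    (\<forall>js. (\<forall>S\<subseteq>{1..n}. js \<noteq> ?a S) \<longrightarrow> I' ''table'' js = I ''table'' js) \<and>
    (\<forall>x. x \<noteq> ''V'' \<and> x \<noteq> ''acc'' \<longrightarrow> R' x = R x) \<and>
    (\<forall>js. js \<noteq> ?js \<longrightarrow> R' ''V'' js = R ''V'' js) \<and> solved n m k p f u s r (I', R')"
  proof (cases "k \<le> s")
    case True
    have "rval (I, R) (score_exp n) = final_score n f r"
      by (rule rval_score_exp) (use r s input in fastforce)
    then have "I' = I" "R' = upd R ''V'' ?js (final_score n f r)"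
      using res True input u s tally[of I] by (auto simp: body_def put_value_def)
    moreover have "opt_value n k p f u s r = final_score n f r"
      using True \<open>s \<le> k\<close> by (cases u) auto
    ultimately show ?thesis
      using True input by (auto simp: upd_def solved_def)
  next
    case False
    then have "s < k" by simp
    define Ss where "Ss = map set (subseqs [1..<Suc n])"
    have Ss: "set Ss = Pow {1..n}" "distinct Ss"
      unfolding Ss_def using subseqs_powset[of "[1..<Suc n]"]
      by (auto simp: distinct_set_subseqs atLeastLessThanSuc_atLeastAtMost simp del: distinct_map)
    obtain I\<^sub>1 R\<^sub>1 where R1: "result (decide_all n Ss) (I, upd R ''acc'' [] 0) = (I\<^sub>1, R\<^sub>1)"
      by fastforce
    define N where "N = R ''V'' ((u - 1) # s # map r [1..<Suc n])"
    define Y where "Y S = R ''V'' ((u - 1) # Suc s # map (add_votes S r) [1..<Suc n])" for S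
    define rej where "rej S \<longleftrightarrow> k \<le> s + (u - 1) \<and> \<not> N \<le> Y S" for S
    have dec: "(\<forall>x. x \<noteq> ''table'' \<longrightarrow> I\<^sub>1 x = I x) \<and> (\<forall>x. x \<noteq> ''acc'' \<longrightarrow> R\<^sub>1 x = upd R ''acc'' [] 0 x) \<and>
      (\<forall>S\<in>set Ss. I\<^sub>1 ''table'' (?a S) = (if rej S then 0 else 1)) \<and>
      (\<forall>js. js \<notin> ?a ` set Ss \<longrightarrow> I\<^sub>1 ''table'' js = I ''table'' js) \<and>
      R\<^sub>1 ''acc'' [] = upd R ''acc'' [] 0 ''acc'' [] +
        (\<Sum>S\<leftarrow>Ss. subset_prob n p S * (if rej S then N else Y S))"
      unfolding rej_def N_def Y_def
      by (rule result_decide_all[OF _ _ _ _ _ _ _ _ R1])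
        (use Ss input u s r in \<open>auto simp: upd_def\<close>)
    have acc: "R\<^sub>1 ''acc'' [] = (\<Sum>S\<in>Pow {1..n}. subset_prob n p S * (if rej S then N else Y S))"
      using dec Ss(1) by (simp add: upd_def sum.distinct_set_conv_list[OF Ss(2), symmetric] del: address.simps)
    have "result (put_value n (RGet ''acc'' [])) (I\<^sub>1, R\<^sub>1) = (I', R')"
      using res False input s R1 by (simp add: body_def Ss_def)
    then have res': "I' = I\<^sub>1" "R' = upd R\<^sub>1 ''V'' ?js (R\<^sub>1 ''acc'' [])"
      using dec u s tally[of I\<^sub>1] by (auto simp: put_value_def)
    have tab: "I' ''table'' js \<in> {0, 1}" for js
    proof (cases "js \<in> ?a ` set Ss")
      case True
      then obtain S where "S \<in> set Ss" "js = ?a S" by blast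
      then have "I\<^sub>1 ''table'' js = (if rej S then 0 else 1)" using dec by blast
      then show ?thesis by (simp add: res')
    next
      case False
      then have "I\<^sub>1 ''table'' js = I ''table'' js" using dec by blast
      then show ?thesis using input(5)[of js] by (simp add: res')
    qed
    have "solved n m k p f u s r (I', R')"
      unfolding solved_def
    proof
      assume feasible: "k \<le> s + u"
      with \<open>s < k\<close> obtain v where v: "u = Suc v" by (cases u) auto
      \<comment> \<open>Selecting preserves feasibility, as k <= s + Suc v, so this value is always
        available.\<close>
      have Y: "Y S = opt_value n k p f v (Suc s) (add_votes S r)" for S
      proof -
        have "\<forall>i\<in>{1..n}. add_votes S r i \<le> Suc s"
          using r(2) by (auto simp: add_votes_def le_SucI)
        then have "solved n m k p f v (Suc s) (add_votes S r) (I, R)"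
          using before \<open>s < k\<close> v by (auto simp: solved_before_def)
        then show ?thesis using feasible v by (simp add: solved_def Y_def)
      qed
      \<comment> \<open>If rejecting would leave too few candidates, \<open>N\<close> may be
        arbitrary; the guard in \<open>rej\<close> then discards it.\<close>
      have N: "N = opt_value n k p f v s r" if "k \<le> s + v"
      proof -
        have "solved n m k p f v s r (I, R)"
          using before \<open>s < k\<close> v r(2) by (auto simp: solved_before_def)
        then show ?thesis using that v by (simp add: solved_def N_def)
      qed
      have rej: "rej S \<longleftrightarrow> rejects n k p f v s r S" for S
        using N by (auto simp: rej_def rejects_def Y v)
      have summand: "subset_prob n p S * (if rej S then N else Y S) = subset_prob n p S *
        (if k \<le> s + v \<and> opt_value n k p f v (Suc s) (add_votes S r) < opt_value n k p f v s r
         then opt_value n k p f v s r else opt_value n k p f v (Suc s) (add_votes S r))" for S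
        unfolding rej rejects_def using N Y by auto
      have "R\<^sub>1 ''acc'' [] = opt_value n k p f u s r"
        unfolding acc summand using \<open>s < k\<close> by (simp add: v)
      moreover have "I' ''table'' (?a S) = (if rejects n k p f (u - 1) s r S then 0 else 1)"
        if "S \<subseteq> {1..n}" for S
        using dec Ss that by (simp add: res' rej v del: address.simps)
      ultimately show "snd (I', R') ''V'' ?js = opt_value n k p f u s r \<and> (s < k \<longrightarrow>
          (\<forall>S\<subseteq>{1..n}. fst (I', R') ''table'' (?a S) = (if rejects n k p f (u - 1) s r S then 0 else 1)))"
        by (simp add: res' upd_def del: address.simps)
    qed
    moreover have "I' ''table'' js = I ''table'' js" if "\<forall>S\<subseteq>{1..n}. js \<noteq> ?a S" for js
    proof -
      have "js \<notin> ?a ` set Ss" using that unfolding Ss by blast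
      then show ?thesis using dec unfolding res' by blast
    qed
    moreover have "\<forall>x. x \<noteq> ''table'' \<longrightarrow> I' x = I x" using dec unfolding res' by blast
    moreover have "\<forall>x. x \<noteq> ''V'' \<and> x \<noteq> ''acc'' \<longrightarrow> R' x = R x"
      "\<forall>js. js \<noteq> ?js \<longrightarrow> R' ''V'' js = R ''V'' js"
      using dec by (auto simp: res' upd_def simp del: address.simps)
    ultimately show ?thesis using tab by blast
  qed
  then show new: "solved n m k p f u s r (I', R')"
    and "\<And>x. x \<noteq> ''table'' \<Longrightarrow> I' x = I x"
    and "input_intact m k p f (I', R')"
    using input by (auto simp: input_intact_def)
  have keep_V: "\<forall>js. js \<noteq> ?js \<longrightarrow> R' ''V'' js = R ''V'' js"
    using main by (elim conjE)
  have keep_table: "\<forall>js. (\<forall>S\<subseteq>{1..n}. js \<noteq> ?a S) \<longrightarrow> I' ''table'' js = I ''table'' js"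
    using main by (elim conjE)
  fix u' s' r'
  assume old: "solved n m k p f u' s' r' (I, R)" and "u' \<le> m"
  show "solved n m k p f u' s' r' (I', R')"
  proof (cases "u' = u \<and> s' = s \<and> (\<forall>i\<in>{1..n}. r' i = r i)")
    case True
    then show ?thesis using new solved_cong[of n r' r] by auto
  next
    case False
    have "u' # s' # map r' [1..<Suc n] \<noteq> ?js" using False by auto
    then have V: "R' ''V'' (u' # s' # map r' [1..<Suc n]) = R ''V'' (u' # s' # map r' [1..<Suc n])"
      using keep_V by blast
    \<comment> \<open>Truncated subtraction separates the two layers here because both are at most
      m.\<close>
    have "m + 1 - u' \<noteq> m + 1 - u" if "u' \<noteq> u" using that \<open>u' \<le> m\<close> \<open>u \<le> m\<close> by linarith
    then have "address n (m + 1 - u', s', S', r') \<noteq> ?a S" for S S'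
      using False by (auto simp only: address_eq_iff)
    then have "I' ''table'' (address n (m + 1 - u', s', S', r')) =
        I ''table'' (address n (m + 1 - u', s', S', r'))" for S'
      using keep_table by blast
    with V old show ?thesis by (simp add: solved_def del: address.simps)
  qed
qed

text \<open>Advances \<open>solved_before\<close> by one value of s: with \<open>Good\<close> as
  \<open>solved\<close> at (u, s), the loops cover {0, ..., s}^n, exactly the tallies required
  there.\<close>

lemma runs_nest_body:
  assumes u: "I ''u'' [] = u" "u \<le> m" and s: "I ''s'' [] = s" "s \<le> k"
    and intact: "input_intact m k p f (I, R)"
    and before: "solved_before n m k p f u s (I, R)"
  shows "runs (nest ''s'' n (body n)) (I, R) ((24 * (m + k + 1)) ^ n * cost_bound (body n))
    (\<lambda>(I', R'). I' ''u'' [] = u \<and> I' ''s'' [] = s \<and> input_intact m k p f (I', R') \<and>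
      solved_before n m k p f u (Suc s) (I', R'))"
proof -
  define Ctx where "Ctx = (\<lambda>(J, R'). J ''u'' [] = u \<and> J ''s'' [] = s \<and>
    input_intact m k p f (J, R') \<and> solved_before n m k p f u s (J, R'))"
  define Good where "Good = solved n m k p f u s"
  have "runs (nest ''s'' n (body n)) (I, R) ((24 * (m + k + 1)) ^ n * cost_bound (body n))
    (\<lambda>(I', R'). Ctx (I', R') \<and> (\<forall>j>n. I' ''r'' [j] = I ''r'' [j]) \<and>
      (\<forall>r. (\<forall>j\<in>{1..n}. r j \<le> s) \<and> (\<forall>j\<in>{n<..n}. r j = I ''r'' [j]) \<longrightarrow> Good r (I', R')) \<and>
      (\<forall>r. Good r (I, R) \<longrightarrow> Good r (I', R')))"
  proof (rule runs_nest[where N = s and n = n and Ctx = Ctx and Good = Good])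
    fix J Q
    assume ctx: "Ctx (J, Q)" and r: "\<And>j. j \<in> {1..n} \<Longrightarrow> J ''r'' [j] \<le> s"
    obtain J' R'' where res: "result (body n) (J, Q) = (J', R'')" by fastforce
    have hyps: "J ''u'' [] = u" "u \<le> m" "J ''s'' [] = s" "s \<le> k"
      "\<forall>i\<in>{1..n}. J ''r'' [i] = (\<lambda>i. J ''r'' [i]) i"
      "\<forall>i\<in>{1..n}. (\<lambda>i. J ''r'' [i]) i \<le> s"
      "input_intact m k p f (J, Q)" "solved_before n m k p f u s (J, Q)"
      using ctx r u s by (auto simp: Ctx_def)
    note body = result_body[OF hyps res]
    have "solved_before n m k p f u s (J', R'')"
      unfolding solved_before_def
    proof (intro allI impI)
      fix u' s' r
      assume *: "(u' < u \<and> s' \<le> k \<or> u' = u \<and> s' < s) \<and> (\<forall>i\<in>{1..n}. r i \<le> s')"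
      then have "solved n m k p f u' s' r (J, Q)"
        using hyps(8) unfolding solved_before_def by blast
      then show "solved n m k p f u' s' r (J', R'')"
        by (rule body(4)) (use * \<open>u \<le> m\<close> in auto)
    qed
    moreover have "Good r (J', R'')" if "\<forall>j\<in>{1..n}. r j = J ''r'' [j]" for r
      using body(3) that solved_cong[of n r "\<lambda>i. J ''r'' [i]"] by (simp add: Good_def)
    moreover have "Good r (J', R'')" if "Good r (J, Q)" for r
      using body(4) that \<open>u \<le> m\<close> by (simp add: Good_def)
    ultimately show "runs (body n) (J, Q) (cost_bound (body n)) (\<lambda>(I', R'). Ctx (I', R') \<and>
        I' ''r'' = J ''r'' \<and> (\<forall>r. (\<forall>j\<in>{1..n}. r j = J ''r'' [j]) \<longrightarrow> Good r (I', R')) \<and>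
        (\<forall>r. Good r (J, Q) \<longrightarrow> Good r (I', R')))"
      using body(1,2) hyps
      by (intro runs_loop_free loop_free_body) (simp add: res Ctx_def)
  qed (use u s intact before in \<open>auto simp: Ctx_def Good_def upd_def input_intact_def
        solved_before_def solved_def cost_bound_pos[OF loop_free_body, simplified]\<close>)
  then show ?thesis
  proof (rule runs_mono)
    fix st
    assume *: "case st of (I', R') \<Rightarrow> Ctx (I', R') \<and> (\<forall>j>n. I' ''r'' [j] = I ''r'' [j]) \<and>
      (\<forall>r. (\<forall>j\<in>{1..n}. r j \<le> s) \<and> (\<forall>j\<in>{n<..n}. r j = I ''r'' [j]) \<longrightarrow> Good r (I', R')) \<and>
      (\<forall>r. Good r (I, R) \<longrightarrow> Good r (I', R'))"
    then show "case st of (I', R') \<Rightarrow> I' ''u'' [] = u \<and> I' ''s'' [] = s \<and>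
      input_intact m k p f (I', R') \<and> solved_before n m k p f u (Suc s) (I', R')"
      by (auto simp: Ctx_def Good_def solved_before_def less_Suc_eq)
  qed
qed

section \<open>The two outer loops and the running time\<close>

lemma solved_before_upd:
  "x \<noteq> ''table'' \<Longrightarrow> solved_before n m k p f u s (upd I x js v, R) = solved_before n m k p f u s (I, R)"
  by (simp add: solved_before_def solved_def upd_def)

lemma input_intact_upd:
  "x \<notin> {''table'', ''m'', ''k''} \<Longrightarrow> input_intact m k p f (upd I x js v, R) = input_intact m k p f (I, R)"
  by (auto simp: input_intact_def upd_def)

lemma solved_before_Suc:
  "solved_before n m k p f u (Suc k) st \<Longrightarrow> solved_before n m k p f (Suc u) 0 st"
  by (auto simp: solved_before_def less_Suc_eq[of _ u] less_Suc_eq_le[of _ k])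

lemma runs_dynamic_program:
  assumes "input_intact m k p f (I, R)"
  shows "runs (dynamic_program n) (I, R)
    (24 * (m + k + 1) * (24 * (m + k + 1) * ((24 * (m + k + 1)) ^ n * cost_bound (body n))))
    (\<lambda>st. input_intact m k p f st \<and> solved_before n m k p f (Suc m) 0 st)"
  unfolding dynamic_program_def
proof (rule runs_For[where N = m and Inv = "\<lambda>u st. input_intact m k p f st \<and> solved_before n m k p f u 0 st"])
  fix u I R
  assume u: "u \<le> m" "input_intact m k p f (I, R) \<and> solved_before n m k p f u 0 (I, R)" "I ''u'' [] = u"
  let ?Inv = "\<lambda>s st. fst st ''u'' [] = u \<and> input_intact m k p f st \<and> solved_before n m k p f u s st"
  have "runs (For ''s'' [] ''k'' (nest ''s'' n (body n))) (I, R)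
    (24 * (m + k + 1) * ((24 * (m + k + 1)) ^ n * cost_bound (body n))) (?Inv (Suc k))"
  proof (rule runs_For[where N = k])
    fix s J R'
    assume "s \<le> k" "?Inv s (J, R')" "J ''s'' [] = s"
    then show "runs (nest ''s'' n (body n)) (J, R') ((24 * (m + k + 1)) ^ n * cost_bound (body n))
      (\<lambda>(I', R'). I' ''s'' [] = s \<and> ?Inv (Suc s) (upd I' ''s'' [] (Suc s), R'))"
      using u(1) by (intro runs_mono[OF runs_nest_body])
        (auto simp: solved_before_upd input_intact_upd, auto simp: upd_def)
  next
    show "?Inv 0 (upd I ''s'' [] 0, R)"
      using u by (simp add: solved_before_upd input_intact_upd) (simp add: upd_def)
  next
    show "1 \<le> (24 * (m + k + 1)) ^ n * cost_bound (body n)"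
      using cost_bound_pos[OF loop_free_body] by simp
  qed (simp_all add: input_intact_def)
  then show "runs (For ''s'' [] ''k'' (nest ''s'' n (body n))) (I, R)
    (24 * (m + k + 1) * ((24 * (m + k + 1)) ^ n * cost_bound (body n)))
    (\<lambda>(I', R'). I' ''u'' [] = u \<and> input_intact m k p f (upd I' ''u'' [] (Suc u), R') \<and>
      solved_before n m k p f (Suc u) 0 (upd I' ''u'' [] (Suc u), R'))"
    by (rule runs_mono) (auto simp: solved_before_upd input_intact_upd intro: solved_before_Suc)
next
  show "1 \<le> 24 * (m + k + 1) * ((24 * (m + k + 1)) ^ n * cost_bound (body n))"
    using cost_bound_pos[OF loop_free_body] by simp
next
  show "input_intact m k p f (upd I ''u'' [] 0, R) \<and> solved_before n m k p f 0 0 (upd I ''u'' [] 0, R)"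
    using assms by (simp add: input_intact_upd) (simp add: solved_before_def)
qed (simp_all add: input_intact_def)

theorem theorem4p1:
  fixes n :: nat
  shows "\<exists>(prog :: com) (C :: nat) (d :: nat).
    \<forall>(m :: nat) (k :: nat) (p :: real) (f :: nat \<Rightarrow> real).
      k \<le> m \<and> 0 \<le> p \<and> p \<le> 1 \<longrightarrow>
      (\<exists>T s. exec prog (input_store m k p f) T s \<and>
             T \<le> C * (m + k + 1) ^ d \<and>
             policy_table n m k s \<and>
             optimal_safe_policy n m k p f (table_policy n s))"
\<comment> \<open>Each of the n + 2 nested loops has a limit of at most m + k and contributes a
  factor 24 * (m + k + 1); \<open>cost_bound (body n)\<close> depends on \<open>n\<close>
  only.\<close>
proof (rule exI[of _ "dynamic_program n"], rule exI[of _ "24 ^ (n + 2) * cost_bound (body n)"],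
    rule exI[of _ "n + 2"], intro allI impI, elim conjE)
  fix m k :: nat and p :: real and f :: "nat \<Rightarrow> real"
  assume km: "k \<le> m" and p: "0 \<le> p" "p \<le> 1"
  have "input_intact m k p f (input_store m k p f)"
    by (simp add: input_intact_def input_store_def)
  then obtain T s where T: "exec (dynamic_program n) (input_store m k p f) T s"
      "T \<le> 24 * (m + k + 1) * (24 * (m + k + 1) * ((24 * (m + k + 1)) ^ n * cost_bound (body n)))"
    and intact: "input_intact m k p f s" and solved: "solved_before n m k p f (Suc m) 0 s"
    using runs_dynamic_program[of m k p f "fst (input_store m k p f)" "snd (input_store m k p f)" n]
    unfolding runs_def prod.collapse by blast
  have eq: "24 * x * (24 * x * ((24 * x) ^ n * c)) = 24 ^ (n + 2) * c * x ^ (n + 2)" for x c :: nat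
    by (simp add: power_mult_distrib ac_simps)
  from T(2) have time: "T \<le> 24 ^ (n + 2) * cost_bound (body n) * (m + k + 1) ^ (n + 2)"
    by (simp only: eq)
  have table: "policy_table n m k s"
    using intact by (simp add: policy_table_def input_intact_def)
  have "optimal_safe_policy n m k p f (table_policy n s)"
  proof (rule optimal_safe_policyI[OF p km])
    fix h S u
    assume h: "length h + Suc u = m" "card (selected h) < k" "k \<le> card (selected h) + Suc u"
      and S: "S \<subseteq> {1..n}"
    \<comment> \<open>A voter approves at most all of the selected candidates, so the tally of a
      history lies in the computed range r i <= s.\<close>
    have "solved n m k p f (Suc u) (card (selected h)) (approval_counts h) s"
      using solved h approval_counts_le[of h] by (auto simp: solved_before_def)
    moreover have "m + 1 - Suc u = Suc (length h)" using h(1) by linarith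
    ultimately have "fst s ''table'' (address n (Suc (length h), card (selected h), S, approval_counts h)) =
        (if rejects n k p f u (card (selected h)) (approval_counts h) S then 0 else 1)"
      using h S by (simp add: solved_def del: address.simps)
    then show "table_policy n s h S \<longleftrightarrow>
        \<not> rejects n k p f u (card (selected h)) (approval_counts h) S"
      by (simp add: table_policy_def state_of_eq del: address.simps)
  qed
  with T(1) time table show "\<exists>T s. exec (dynamic_program n) (input_store m k p f) T s \<and>
      T \<le> 24 ^ (n + 2) * cost_bound (body n) * (m + k + 1) ^ (n + 2) \<and>
      policy_table n m k s \<and> optimal_safe_policy n m k p f (table_policy n s)" by blast
qed

end
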